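(* Let $R$ be a commutative noetherian ring, $M$ a finitely generated $R$-module, and $\underline{s} = s_1,\dots,s_d$ a finite sequence of elements of $R$. Let $h$ and $l$ be the integers attached to $(\underline{s}, M)$ described in the context. Given $r \geq 1$, set $$u(r) = (h+l)\left(\sum_{j=0}^{d-1} d^j\right) + r d^d .$$ Then there exists a chain complex map $\phi : T'(\underline{s}^{u(r)};M) \to K(\underline{s}^r;M)$ with $\phi|_{K(\underline{s}^{u(r)};M)} = \kappa^{u(r),r}$. In particular (taking $M = R$), there exists a chain complex map $\phi : T(\underline{s}^{u(r)}) \to K(\underline{s}^r)$ such that $\phi_0 = \kappa^{u(r),r}_0 = \mathrm{id}_R$.
   Context: $\underline{s}^n$ denotes the sequence $s_1^n,\dots,s_d^n$. $K(\underline{s}^n)$ is the Koszul complex on $\underline{s}^n$, i.e. the exterior algebra on $\bigoplus_{i=1}^d R e_i$ ($\deg e_i = 1$) with differential determined by $e_i \mapsto s_i^n$, and $K(\underline{s}^n;M) = K(\underline{s}^n)\otimes_R M$. For $n \geq k > 0$, $\kappa^{n,k} : K(\underline{s}^n;M) \to K(\underline{s}^k;M)$ is the chain map which in degree $m$ sends $e_{i_1}\wedge\cdots\wedge e_{i_m}$ to $(s_{i_1}\cdots s_{i_m})^{n-k}\, e_{i_1}\wedge\cdots\wedge e_{i_m}$ (with coefficients in $M$); it is the identity in degree $0$. The integer $h \ge 0$ (depending on $M$ and $\underline{s}$) is fixed such that for all $r \geq 1$ and all $i \geq 1$ the map $H_i(\kappa^{h+rd,r}) : H_i(K(\underline{s}^{h+rd};M))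 \to H_i(K(\underline{s}^r;M))$ is zero; such an $h$ exists. The integer $l$ is $\max_i l_i$, where for each $i$, $l_i \in \mathbb{N}$ is such that $(0:_M s_i^{l_i}) = (0:_M s_i^{l_i+k})$ for all $k \in \mathbb{N}$. For a finite sequence $\underline{f}$ in $R$, the chain complex $T'(\underline{f};M)$ is constructed as follows: $T'_i = 0$ for $i<0$; $T'_i = K_i(\underline{f};M)$ for $i = 0,1$ with $\partial_1^{T'} = \partial_1^K$; and inductively for $i \geq 2$ one chooses a finite generating set $S_{i-1}$ of the module of cycles $Z_{i-1}(T')$, sets $t_i = |S_{i-1}|$, $T'_i = K_i(\underline{f};M) \oplus R^{t_i}$, where $\partial_i^{T'}$ restricts to $\partial_i^{K}$ on $K_i(\underline{f};M)$ and maps a basis of $R^{t_i}$ onto $S_{i-1}$. Thus $K(\underline{f};M)$ is a subcomplex of $T'(\underline{f};M)$, $H_i(T') = 0$ for $i \geq 1$, and $H_0(T') = M/(\underline{f})M$. $T(\underline{f})$ denotes the Tate resolution of $R/(\underline{f})$: the differential graded $R$-algebra that is a free resolution of $R/(\underline{f})$, obtained from the Koszul complex $K(\underline{f})$ by successively adjoining finitely many variables in each degree $2, 3, \dots$ to kill the homology in degrees $1, 2, \dots$; it contains $K(\underline{f})$ as a dg subalgebra, agreeing with it in degrees $0$ and $1$. In the final assertion $h$ and $l$ (hence $u(r)$) are those for $M=R$. *)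

theory Defs
  imports "HOL-Algebra.Module" "HOL-Algebra.AbelCoset" "HOL-Algebra.Ring_Divisibility" "HOL-Library.Multiset"
begin

section \<open>Modules\<close>

definition ring_module :: "('a, 'p) ring_scheme \<Rightarrow> ('a, 'a) module" where
  "ring_module R = \<lparr>carrier = carrier R, monoid.mult = monoid.mult R, one = monoid.one R,
     ring.zero = ring.zero R, ring.add = ring.add R, smult = monoid.mult R\<rparr>"

definition mod_hom ::
  "('a, 'p) ring_scheme \<Rightarrow> ('a, 'b, 'm) module_scheme \<Rightarrow> ('a, 'c, 'n) module_scheme \<Rightarrow> ('b \<Rightarrow> 'c) set" where
  "mod_hom R M N = {g \<in> hom (add_monoid M) (add_monoid N).
     \<forall>a\<in>carrier R. \<forall>x\<in>carrier M. g (a \<odot>\<^bsub>M\<^esub> x) = a \<odot>\<^bsub>N\<^esub> g x}"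

definition mod_span :: "('a, 'p) ring_scheme \<Rightarrow> ('a, 'b, 'm) module_scheme \<Rightarrow> 'b set \<Rightarrow> 'b set" where
  "mod_span R M S = \<Inter> {N. submodule N R M \<and> S \<subseteq> N}"

definition fin_gen_module :: "('a, 'p) ring_scheme \<Rightarrow> ('a, 'b, 'm) module_scheme \<Rightarrow> bool" where
  "fin_gen_module R M \<longleftrightarrow> (\<exists>S \<subseteq> carrier M. finite S \<and> mod_span R M S = carrier M)"

text \<open>The direct sum of copies of \<open>M\<close> indexed by \<open>A\<close>. The fields \<open>mult\<close> and \<open>one\<close>, which a
  module record inherits from rings, play no role for modules.\<close>

definition direct_sum :: "('a, 'b, 'm) module_scheme \<Rightarrow> 'i set \<Rightarrow> ('a, 'i \<Rightarrow> 'b) module" where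
  "direct_sum M A = \<lparr>
     carrier = {x. (\<forall>i. x i \<in> carrier M) \<and> (\<forall>i. i \<notin> A \<longrightarrow> x i = \<zero>\<^bsub>M\<^esub>) \<and> finite {i. x i \<noteq> \<zero>\<^bsub>M\<^esub>}},
     monoid.mult = undefined, one = undefined,
     ring.zero = (\<lambda>i. \<zero>\<^bsub>M\<^esub>), ring.add = (\<lambda>x y i. x i \<oplus>\<^bsub>M\<^esub> y i), smult = (\<lambda>a x i. a \<odot>\<^bsub>M\<^esub> x i)\<rparr>"

abbreviation free_module :: "('a, 'p) ring_scheme \<Rightarrow> 'i set \<Rightarrow> ('a, 'i \<Rightarrow> 'a) module" where
  "free_module R A \<equiv> direct_sum (ring_module R) A"

definition single :: "('b, 'm) ring_scheme \<Rightarrow> 'i \<Rightarrow> 'b \<Rightarrow> 'i \<Rightarrow> 'b" where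
  "single M i a = (\<lambda>j. if j = i then a else \<zero>\<^bsub>M\<^esub>)"

definition prod_module ::
  "('a, 'b, 'm) module_scheme \<Rightarrow> ('a, 'c, 'n) module_scheme \<Rightarrow> ('a, 'b \<times> 'c) module" where
  "prod_module M N = \<lparr>carrier = carrier M \<times> carrier N,
     monoid.mult = undefined, one = undefined,
     ring.zero = (\<zero>\<^bsub>M\<^esub>, \<zero>\<^bsub>N\<^esub>),
     ring.add = (\<lambda>(x, y) (x', y'). (x \<oplus>\<^bsub>M\<^esub> x', y \<oplus>\<^bsub>N\<^esub> y')),
     smult = (\<lambda>a (x, y). (a \<odot>\<^bsub>M\<^esub> x, a \<odot>\<^bsub>N\<^esub> y))\<rparr>"


section \<open>Chain complexes\<close>

text \<open>Complexes are concentrated in nonnegative degrees; \<open>cdiff C i\<close> goes from degree \<open>i\<close> to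
  degree \<open>i - 1\<close> and is not used for \<open>i = 0\<close>.\<close>

record ('a, 'c) chain_cx =
  cobj :: "nat \<Rightarrow> ('a, 'c) module"
  cdiff :: "nat \<Rightarrow> 'c \<Rightarrow> 'c"

definition cycles :: "('a, 'c) chain_cx \<Rightarrow> nat \<Rightarrow> 'c set" where
  "cycles C i = (if i = 0 then carrier (cobj C 0) else a_kernel (cobj C i) (cobj C (i - 1)) (cdiff C i))"

definition boundaries :: "('a, 'c) chain_cx \<Rightarrow> nat \<Rightarrow> 'c set" where
  "boundaries C i = cdiff C (Suc i) ` carrier (cobj C (Suc i))"

definition homology :: "('a, 'c) chain_cx \<Rightarrow> nat \<Rightarrow> 'c set monoid" where
  "homology C i = (cobj C i)\<lparr>carrier := cycles C i\<rparr> A_Mod boundaries C i"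

text \<open>The map sending the class of a cycle \<open>z\<close> to the class of \<open>g i z\<close> in \<open>D\<close>. All members
  \<open>z\<close> of a class \<open>c\<close> give the same coset when \<open>g\<close> is a chain map.\<close>

definition homology_map :: "('a, 'c) chain_cx \<Rightarrow> (nat \<Rightarrow> 'b \<Rightarrow> 'c) \<Rightarrow> nat \<Rightarrow> 'b set \<Rightarrow> 'c set" where
  "homology_map D g i c = (\<Union>z\<in>c. boundaries D i +>\<^bsub>cobj D i\<^esub> g i z)"

definition chain_map ::
  "('a, 'p) ring_scheme \<Rightarrow> ('a, 'b) chain_cx \<Rightarrow> ('a, 'c) chain_cx \<Rightarrow> (nat \<Rightarrow> 'b \<Rightarrow> 'c) \<Rightarrow> bool" where
  "chain_map R C D g \<longleftrightarrow>
     (\<forall>i. g i \<in> mod_hom R (cobj C i) (cobj D i)) \<and>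
     (\<forall>i. \<forall>x\<in>carrier (cobj C (Suc i)). g i (cdiff C (Suc i) x) = cdiff D (Suc i) (g (Suc i) x))"


section \<open>Koszul complexes\<close>

text \<open>A subset \<open>I = {i\<^sub>1 < \<dots> < i\<^sub>m}\<close> of \<open>{..<length f}\<close> stands for the basis element
  \<open>e\<^sub>I = e\<^bsub>i\<^sub>1\<^esub> \<and> \<dots> \<and> e\<^bsub>i\<^sub>m\<^esub>\<close> of the exterior algebra, and \<open>x\<close> for the element \<open>\<Sum>\<^sub>I x I e\<^sub>I\<close>.
  The derivation with \<open>e\<^sub>i \<mapsto> f ! i\<close> sends \<open>e\<^sub>I\<close> to the sum over \<open>i \<in> I\<close> of
  \<open>(-1)^card {j \<in> I. j < i} (f ! i) e\<^bsub>I - {i}\<^esub>\<close>; below, \<open>J = I - {i}\<close>.\<close>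

definition koszul ::
  "('a, 'b, 'm) module_scheme \<Rightarrow> 'a list \<Rightarrow> ('a, nat set \<Rightarrow> 'b) chain_cx" where
  "koszul M f = \<lparr>
     cobj = (\<lambda>m. direct_sum M {I. I \<subseteq> {..<length f} \<and> card I = m}),
     cdiff = (\<lambda>m x J. \<Oplus>\<^bsub>M\<^esub>i \<in> {..<length f} - J.
        [((- 1 :: int) ^ card {j \<in> J. j < i})] \<cdot>\<^bsub>M\<^esub> ((f ! i) \<odot>\<^bsub>M\<^esub> x (insert i J)))\<rparr>"

definition pow_seq :: "('a, 'p) ring_scheme \<Rightarrow> 'a list \<Rightarrow> nat \<Rightarrow> 'a list" where
  "pow_seq R s n = map (\<lambda>a. a [^]\<^bsub>R\<^esub> n) s"

definition kappa ::
  "('a, 'p) ring_scheme \<Rightarrow> ('a, 'b, 'm) module_scheme \<Rightarrow> 'a list \<Rightarrow> nat \<Rightarrow> nat \<Rightarrow>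
    nat \<Rightarrow> (nat set \<Rightarrow> 'b) \<Rightarrow> nat set \<Rightarrow> 'b" where
  "kappa R M s n k m x = (\<lambda>I. if I \<subseteq> {..<length s}
     then ((\<Otimes>\<^bsub>R\<^esub>i\<in>I. s ! i) [^]\<^bsub>R\<^esub> (n - k)) \<odot>\<^bsub>M\<^esub> x I else \<zero>\<^bsub>M\<^esub>)"


section \<open>The numbers $h$, $l$ and $u(r)$\<close>

definition kills_homology ::
  "('a, 'p) ring_scheme \<Rightarrow> ('a, 'b, 'm) module_scheme \<Rightarrow> 'a list \<Rightarrow> nat \<Rightarrow> bool" where
  "kills_homology R M s h \<longleftrightarrow> (\<forall>r\<ge>1. \<forall>i\<ge>1.
     \<forall>c\<in>carrier (homology (koszul M (pow_seq R s (h + r * length s))) i).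
       homology_map (koszul M (pow_seq R s r)) (kappa R M s (h + r * length s) r) i c =
       \<one>\<^bsub>homology (koszul M (pow_seq R s r)) i\<^esub>)"

definition zero_colon :: "('a, 'b, 'm) module_scheme \<Rightarrow> 'a \<Rightarrow> 'b set" where
  "zero_colon M a = {x \<in> carrier M. a \<odot>\<^bsub>M\<^esub> x = \<zero>\<^bsub>M\<^esub>}"

text \<open>For the empty sequence the maximum is taken to be \<open>0\<close>.\<close>

definition stabilises_colon ::
  "('a, 'p) ring_scheme \<Rightarrow> ('a, 'b, 'm) module_scheme \<Rightarrow> 'a list \<Rightarrow> nat \<Rightarrow> bool" where
  "stabilises_colon R M s l \<longleftrightarrow> (\<exists>li :: nat \<Rightarrow> nat.
     (\<forall>i<length s. \<forall>k. zero_colon M ((s ! i) [^]\<^bsub>R\<^esub> li i) = zero_colon M ((s ! i) [^]\<^bsub>R\<^esub> (li i + k))) \<and>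
     l = Max (insert 0 (li ` {..<length s})))"

definition u_exp :: "nat \<Rightarrow> nat \<Rightarrow> nat \<Rightarrow> nat \<Rightarrow> nat" where
  "u_exp d h l r = (h + l) * (\<Sum>j<d. d ^ j) + r * d ^ d"


section \<open>The complex $T'$\<close>

text \<open>The standard basis vector \<open>e\<^sub>j\<close> of the summand \<open>R\<^bsup>t i\<^esup>\<close> in degree \<open>i\<close> is mapped to \<open>b i j\<close>.\<close>

definition tprime ::
  "('a, 'p) ring_scheme \<Rightarrow> ('a, 'b, 'm) module_scheme \<Rightarrow> 'a list \<Rightarrow> (nat \<Rightarrow> nat) \<Rightarrow>
    (nat \<Rightarrow> nat \<Rightarrow> (nat set \<Rightarrow> 'b) \<times> (nat \<Rightarrow> 'a)) \<Rightarrow> ('a, (nat set \<Rightarrow> 'b) \<times> (nat \<Rightarrow> 'a)) chain_cx" where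
  "tprime R M f t b =
     (let T = (\<lambda>i. prod_module (cobj (koszul M f) i) (free_module R {..<t i}))
      in \<lparr>cobj = T,
          cdiff = (\<lambda>i (x, c). (cdiff (koszul M f) i x, \<zero>\<^bsub>free_module R {..<t (i - 1)}\<^esub>)
             \<oplus>\<^bsub>T (i - 1)\<^esub> (\<Oplus>\<^bsub>T (i - 1)\<^esub>j\<in>{..<t i}. c j \<odot>\<^bsub>T (i - 1)\<^esub> b i j))\<rparr>)"

text \<open>The conditions in degree \<open>i\<close> only involve the complex in degrees below \<open>i\<close>, so they
  express the inductive choices of the generating sets \<open>S = S\<^bsub>i - 1\<^esub>\<close>.\<close>

definition tprime_choice ::
  "('a, 'p) ring_scheme \<Rightarrow> ('a, 'b, 'm) module_scheme \<Rightarrow> 'a list \<Rightarrow> (nat \<Rightarrow> nat) \<Rightarrow>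
    (nat \<Rightarrow> nat \<Rightarrow> (nat set \<Rightarrow> 'b) \<times> (nat \<Rightarrow> 'a)) \<Rightarrow> bool" where
  "tprime_choice R M f t b \<longleftrightarrow> t 0 = 0 \<and> t 1 = 0 \<and>
     (\<forall>i\<ge>2. \<exists>S. finite S \<and> S \<subseteq> cycles (tprime R M f t b) (i - 1) \<and>
        mod_span R (cobj (tprime R M f t b) (i - 1)) S = cycles (tprime R M f t b) (i - 1) \<and>
        t i = card S \<and> bij_betw (b i) {..<t i} S)"


section \<open>Tate resolutions\<close>

text \<open>A pair \<open>(i, j)\<close> with \<open>i \<ge> 1\<close> and \<open>j < n i\<close> is the \<open>j\<close>-th variable of degree \<open>i\<close>. Variables of
  odd degree are exterior, those of even degree are divided power variables. A multiset \<open>\<alpha>\<close> stands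
  for the ordered product (in the lexicographic order) of the divided powers \<open>v^(count \<alpha> v)\<close>.\<close>

definition tate_monomials :: "(nat \<Rightarrow> nat) \<Rightarrow> (nat \<times> nat) multiset set" where
  "tate_monomials n = {\<alpha>. \<forall>v\<in>#\<alpha>. 1 \<le> fst v \<and> snd v < n (fst v) \<and> (odd (fst v) \<longrightarrow> count \<alpha> v = 1)}"

definition mon_degree :: "(nat \<times> nat) multiset \<Rightarrow> nat" where
  "mon_degree \<alpha> = (\<Sum>v\<in>#\<alpha>. fst v)"

text \<open>The product of the monomials \<open>\<alpha>\<close> and \<open>\<beta>\<close> is \<open>mon_coeff \<alpha> \<beta>\<close> times \<open>\<alpha> + \<beta>\<close>: the square of an
  odd variable is zero, each transposition of two odd variables contributes a sign, and
  \<open>v^(p) v^(q) = (p + q choose p) v^(p + q)\<close>.\<close>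

definition mon_coeff :: "(nat \<times> nat) multiset \<Rightarrow> (nat \<times> nat) multiset \<Rightarrow> int" where
  "mon_coeff \<alpha> \<beta> = (if \<exists>v. odd (fst v) \<and> v \<in># \<alpha> \<and> v \<in># \<beta> then 0
     else (- 1) ^ card {(v, w). v \<in># \<alpha> \<and> w \<in># \<beta> \<and> odd (fst v) \<and> odd (fst w) \<and>
                               (w, v) \<in> less_than <*lex*> less_than}
        * (\<Prod>v\<in>set_mset (\<alpha> + \<beta>). int ((count \<alpha> v + count \<beta> v) choose count \<alpha> v)))"

definition tate_mult ::
  "('a, 'p) ring_scheme \<Rightarrow> ((nat \<times> nat) multiset \<Rightarrow> 'a) \<Rightarrow> ((nat \<times> nat) multiset \<Rightarrow> 'a) \<Rightarrow>
    (nat \<times> nat) multiset \<Rightarrow> 'a" where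
  "tate_mult R x y = (\<lambda>\<gamma>. \<Oplus>\<^bsub>R\<^esub>\<alpha>\<in>{\<alpha>. \<alpha> \<subseteq># \<gamma>}. [(mon_coeff \<alpha> (\<gamma> - \<alpha>))] \<cdot>\<^bsub>R\<^esub> (x \<alpha> \<otimes>\<^bsub>R\<^esub> y (\<gamma> - \<alpha>)))"

definition tate_algebra ::
  "('a, 'p) ring_scheme \<Rightarrow> (nat \<Rightarrow> nat) \<Rightarrow> ('a, (nat \<times> nat) multiset \<Rightarrow> 'a) module" where
  "tate_algebra R n =
     (free_module R (tate_monomials n))\<lparr>monoid.mult := tate_mult R, one := single R {#} \<one>\<^bsub>R\<^esub>\<rparr>"

definition tate_complex ::
  "('a, 'p) ring_scheme \<Rightarrow> (nat \<Rightarrow> nat) \<Rightarrow> (((nat \<times> nat) multiset \<Rightarrow> 'a) \<Rightarrow> ((nat \<times> nat) multiset \<Rightarrow> 'a)) \<Rightarrow>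
    ('a, (nat \<times> nat) multiset \<Rightarrow> 'a) chain_cx" where
  "tate_complex R n D = \<lparr>
     cobj = (\<lambda>m. free_module R {\<alpha> \<in> tate_monomials n. mon_degree \<alpha> = m}),
     cdiff = (\<lambda>m. D)\<rparr>"

text \<open>\<open>D\<close> is a differential making \<open>tate_algebra R n\<close> a dg algebra, compatible with divided powers.\<close>

definition tate_differential ::
  "('a, 'p) ring_scheme \<Rightarrow> (nat \<Rightarrow> nat) \<Rightarrow> (((nat \<times> nat) multiset \<Rightarrow> 'a) \<Rightarrow> ((nat \<times> nat) multiset \<Rightarrow> 'a)) \<Rightarrow> bool" where
  "tate_differential R n D \<longleftrightarrow>
     D \<in> mod_hom R (tate_algebra R n) (tate_algebra R n) \<and>
     (\<forall>x\<in>carrier (cobj (tate_complex R n D) 0). D x = \<zero>\<^bsub>tate_algebra R n\<^esub>) \<and>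
     (\<forall>m. \<forall>x\<in>carrier (cobj (tate_complex R n D) (Suc m)). D x \<in> carrier (cobj (tate_complex R n D) m)) \<and>
     (\<forall>x\<in>carrier (tate_algebra R n). D (D x) = \<zero>\<^bsub>tate_algebra R n\<^esub>) \<and>
     (\<forall>p. \<forall>x\<in>carrier (cobj (tate_complex R n D) p). \<forall>y\<in>carrier (tate_algebra R n).
        D (x \<otimes>\<^bsub>tate_algebra R n\<^esub> y) =
          D x \<otimes>\<^bsub>tate_algebra R n\<^esub> y \<oplus>\<^bsub>tate_algebra R n\<^esub>
          [((- 1 :: int) ^ p)] \<cdot>\<^bsub>tate_algebra R n\<^esub> (x \<otimes>\<^bsub>tate_algebra R n\<^esub> D y)) \<and>
     (\<forall>i j k. 1 \<le> i \<and> even i \<and> j < n i \<longrightarrow>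
        D (single R (replicate_mset (Suc k) (i, j)) \<one>\<^bsub>R\<^esub>) =
          D (single R {#(i, j)#} \<one>\<^bsub>R\<^esub>) \<otimes>\<^bsub>tate_algebra R n\<^esub> single R (replicate_mset k (i, j)) \<one>\<^bsub>R\<^esub>)"

definition tate_stage :: "(nat \<Rightarrow> nat) \<Rightarrow> nat \<Rightarrow> nat \<Rightarrow> nat" where
  "tate_stage n k = (\<lambda>i. if i \<le> k then n i else 0)"

text \<open>The variables of degree 1 with their boundaries span the Koszul complex on \<open>f\<close>. For
  \<open>k \<ge> 1\<close>, the boundaries of the variables of degree \<open>k + 1\<close> are cycles whose classes generate
  the homology in degree \<open>k\<close> of the dg subalgebra generated by the variables of degree at
  most \<open>k\<close>.\<close>

definition tate_resolution ::
  "('a, 'p) ring_scheme \<Rightarrow> 'a list \<Rightarrow> (nat \<Rightarrow> nat) \<Rightarrow>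
    (((nat \<times> nat) multiset \<Rightarrow> 'a) \<Rightarrow> ((nat \<times> nat) multiset \<Rightarrow> 'a)) \<Rightarrow> bool" where
  "tate_resolution R f n D \<longleftrightarrow>
     tate_differential R n D \<and>
     n 1 = length f \<and>
     (\<forall>j<length f. D (single R {#(1, j)#} \<one>\<^bsub>R\<^esub>) = single R {#} (f ! j)) \<and>
     (\<forall>k\<ge>1. cycles (tate_complex R (tate_stage n k) D) k =
        mod_span R (cobj (tate_complex R (tate_stage n k) D) k)
          (boundaries (tate_complex R (tate_stage n k) D) k \<union>
           {D (single R {#(Suc k, j)#} \<one>\<^bsub>R\<^esub>) |j. j < n (Suc k)}))"

end

theory Submission
  imports Defs
begin

section \<open>Module homomorphisms\<close>

text \<open>Write d for \<open>length s\<close>. The complex T' is the Koszul complex on s^u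
  together with free generators whose boundaries are cycles, so \<open>kappa\<close> has to be
  extended over these generators. Suppose that a map into the Koszul complex on s^v is known up to
  degree i, and let e be a generator of degree i + 1 with boundary b. The image of b is a cycle, and
  e can be sent to any y whose boundary is that image. Such a y need not exist. But if v is at least
  h + d v', then \<open>kappa\<close> from v to v' factors through a map that kills homology, so
  after composition with it the image of b becomes a boundary (\<open>kappa_cycle_boundary\<close>).
  Values chosen earlier are simply pushed forward: \<open>kappa\<close> is a chain map
  (\<open>kappa_commutes\<close>) and its composites are again of the form \<open>kappa\<close>
  (\<open>kappa_comp\<close>).

  Each such passage handles one degree. The first generators are in degree 2, and the Koszul complex
  vanishes above degree d, so d passages, for the degrees 2 to d + 1, suffice. Going backwards from
  r, the exponents may be taken as U(0) = r and U(m + 1) = h + l + d U(m), and solving this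
  recursion gives U(d) = u(r).

  \<open>chain_map_into_koszul\<close> carries out the argument for any complex with a Koszul part
  \<open>q\<close>, coordinates \<open>c\<close> along the generators and cycles \<open>b\<close> as
  their boundaries. T' has this shape by construction. For the Tate resolution, degrees 0 and 1 are
  the Koszul part, and all monomials of degree at least 2 count as generators.\<close>

lemma mod_homI:
  assumes "\<And>x. x \<in> carrier M \<Longrightarrow> g x \<in> carrier N"
    and "\<And>x y. x \<in> carrier M \<Longrightarrow> y \<in> carrier M \<Longrightarrow> g (x \<oplus>\<^bsub>M\<^esub> y) = g x \<oplus>\<^bsub>N\<^esub> g y"
    and "\<And>a x. a \<in> carrier R \<Longrightarrow> x \<in> carrier M \<Longrightarrow> g (a \<odot>\<^bsub>M\<^esub> x) = a \<odot>\<^bsub>N\<^esub> g x"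
  shows "g \<in> mod_hom R M N"
  using assms by (auto simp: mod_hom_def hom_def)

lemma
  assumes "g \<in> mod_hom R M N"
  shows mod_hom_closed: "x \<in> carrier M \<Longrightarrow> g x \<in> carrier N"
    and mod_hom_add: "x \<in> carrier M \<Longrightarrow> y \<in> carrier M \<Longrightarrow> g (x \<oplus>\<^bsub>M\<^esub> y) = g x \<oplus>\<^bsub>N\<^esub> g y"
    and mod_hom_smult: "a \<in> carrier R \<Longrightarrow> x \<in> carrier M \<Longrightarrow> g (a \<odot>\<^bsub>M\<^esub> x) = a \<odot>\<^bsub>N\<^esub> g x"
  using assms by (auto simp: mod_hom_def hom_def)

lemma mod_hom_zero:
  assumes "module R M" "module R N" "g \<in> mod_hom R M N"
  shows "g \<zero>\<^bsub>M\<^esub> = \<zero>\<^bsub>N\<^esub>"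
proof -
  interpret M: module R M by fact
  interpret N: module R N by fact
  have "g (\<zero>\<^bsub>R\<^esub> \<odot>\<^bsub>M\<^esub> \<zero>\<^bsub>M\<^esub>) = \<zero>\<^bsub>R\<^esub> \<odot>\<^bsub>N\<^esub> g \<zero>\<^bsub>M\<^esub>"
    by (rule mod_hom_smult[OF assms(3)]) auto
  then show ?thesis
    using mod_hom_closed[OF assms(3)] by simp
qed

lemma mod_hom_finsum:
  assumes "module R M" "module R N" "g \<in> mod_hom R M N" "finite A" "f \<in> A \<rightarrow> carrier M"
  shows "g (\<Oplus>\<^bsub>M\<^esub>j\<in>A. f j) = (\<Oplus>\<^bsub>N\<^esub>j\<in>A. g (f j))"
proof -
  interpret M: module R M by fact
  interpret N: module R N by fact
  show ?thesis
    using assms(4,5)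
  proof (induction A)
    case empty
    then show ?case by (simp add: mod_hom_zero[OF assms(1-3)])
  next
    case (insert a A)
    then show ?case
      by (simp add: Pi_def mod_hom_closed[OF assms(3)] mod_hom_add[OF assms(3)])
  qed
qed

lemma mod_hom_comp:
  assumes "g \<in> mod_hom R L M" "k \<in> mod_hom R M N"
  shows "(\<lambda>x. k (g x)) \<in> mod_hom R L N"
  using assms by (auto simp: mod_hom_def hom_def Pi_def)

lemma mod_hom_add_maps:
  assumes "module R N" "g \<in> mod_hom R M N" "k \<in> mod_hom R M N"
  shows "(\<lambda>x. g x \<oplus>\<^bsub>N\<^esub> k x) \<in> mod_hom R M N"
proof -
  interpret N: module R N by fact
  show ?thesis
    by (rule mod_homI)
      (simp_all add: mod_hom_closed[OF assms(2)] mod_hom_closed[OF assms(3)] mod_hom_add[OF assms(2)]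
        mod_hom_add[OF assms(3)] mod_hom_smult[OF assms(2)] mod_hom_smult[OF assms(3)]
        N.add.m_ac N.smult_r_distr)
qed

text \<open>When the \<open>c j\<close> are the coordinates along a basis, this is the linear map
  sending the j-th basis vector to \<open>y j\<close>. It is how the values on adjoined generators,
  once chosen, become a map.\<close>

lemma mod_hom_linear_combination:
  assumes "module R N" "finite A" "y \<in> A \<rightarrow> carrier N"
    and c: "\<And>j. j \<in> A \<Longrightarrow> c j \<in> mod_hom R M (ring_module R)"
  shows "(\<lambda>x. \<Oplus>\<^bsub>N\<^esub>j\<in>A. c j x \<odot>\<^bsub>N\<^esub> y j) \<in> mod_hom R M N"
proof -
  interpret N: module R N by fact
  have cl: "c j x \<in> carrier R" if "j \<in> A" "x \<in> carrier M" for j x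
    using mod_hom_closed[OF c] that by (simp add: ring_module_def)
  have y: "y j \<in> carrier N" if "j \<in> A" for j
    using assms(3) that by auto
  show ?thesis
  proof (rule mod_homI)
    fix x assume x: "x \<in> carrier M"
    then show "(\<Oplus>\<^bsub>N\<^esub>j\<in>A. c j x \<odot>\<^bsub>N\<^esub> y j) \<in> carrier N"
      by (intro N.finsum_closed) (auto simp: cl y)
    fix z assume z: "z \<in> carrier M"
    have "(\<Oplus>\<^bsub>N\<^esub>j\<in>A. c j (x \<oplus>\<^bsub>M\<^esub> z) \<odot>\<^bsub>N\<^esub> y j) = (\<Oplus>\<^bsub>N\<^esub>j\<in>A. c j x \<odot>\<^bsub>N\<^esub> y j \<oplus>\<^bsub>N\<^esub> c j z \<odot>\<^bsub>N\<^esub> y j)"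
      using x z mod_hom_add[OF c]
      by (intro N.finsum_cong') (auto simp: cl y N.smult_l_distr ring_module_def)
    also have "\<dots> = (\<Oplus>\<^bsub>N\<^esub>j\<in>A. c j x \<odot>\<^bsub>N\<^esub> y j) \<oplus>\<^bsub>N\<^esub> (\<Oplus>\<^bsub>N\<^esub>j\<in>A. c j z \<odot>\<^bsub>N\<^esub> y j)"
      using x z by (intro N.finsum_addf) (auto simp: cl y)
    finally show "(\<Oplus>\<^bsub>N\<^esub>j\<in>A. c j (x \<oplus>\<^bsub>M\<^esub> z) \<odot>\<^bsub>N\<^esub> y j)
      = (\<Oplus>\<^bsub>N\<^esub>j\<in>A. c j x \<odot>\<^bsub>N\<^esub> y j) \<oplus>\<^bsub>N\<^esub> (\<Oplus>\<^bsub>N\<^esub>j\<in>A. c j z \<odot>\<^bsub>N\<^esub> y j)" .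
  next
    fix a x assume a: "a \<in> carrier R" and x: "x \<in> carrier M"
    have "(\<Oplus>\<^bsub>N\<^esub>j\<in>A. c j (a \<odot>\<^bsub>M\<^esub> x) \<odot>\<^bsub>N\<^esub> y j) = (\<Oplus>\<^bsub>N\<^esub>j\<in>A. a \<odot>\<^bsub>N\<^esub> (c j x \<odot>\<^bsub>N\<^esub> y j))"
      using a x mod_hom_smult[OF c]
      by (intro N.finsum_cong') (auto simp: cl y N.smult_assoc1 ring_module_def)
    also have "\<dots> = a \<odot>\<^bsub>N\<^esub> (\<Oplus>\<^bsub>N\<^esub>j\<in>A. c j x \<odot>\<^bsub>N\<^esub> y j)"
      using a x by (intro N.finsum_smult_ldistr[symmetric] assms(2)) (auto simp: cl y)
    finally show "(\<Oplus>\<^bsub>N\<^esub>j\<in>A. c j (a \<odot>\<^bsub>M\<^esub> x) \<odot>\<^bsub>N\<^esub> y j) = a \<odot>\<^bsub>N\<^esub> (\<Oplus>\<^bsub>N\<^esub>j\<in>A. c j x \<odot>\<^bsub>N\<^esub> y j)" .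
  qed
qed


section \<open>Constructions of modules\<close>

lemma ring_module_simps [simp]:
  "carrier (ring_module R) = carrier R"
  "\<zero>\<^bsub>ring_module R\<^esub> = \<zero>\<^bsub>R\<^esub>"
  "x \<oplus>\<^bsub>ring_module R\<^esub> y = x \<oplus>\<^bsub>R\<^esub> y"
  "x \<odot>\<^bsub>ring_module R\<^esub> y = x \<otimes>\<^bsub>R\<^esub> y"
  by (simp_all add: ring_module_def)

lemma module_ring_module:
  assumes "cring R"
  shows "module R (ring_module R)"
proof -
  interpret R: cring R by fact
  show ?thesis
  proof (rule moduleI[OF assms])
    show "abelian_group (ring_module R)"
      by (rule abelian_groupI) (auto simp: ring_module_def R.a_ac intro: R.l_neg)
  qed (auto simp: ring_module_def R.l_distr R.r_distr R.m_assoc)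
qed

lemma module_direct_sum:
  fixes M :: "('a, 'b, 'm) module_scheme" and A :: "'i set"
  assumes "module R M"
  shows "module R (direct_sum M A)"
proof -
  interpret M: module R M by fact
  have fin_add: "finite {i. x i \<oplus>\<^bsub>M\<^esub> y i \<noteq> \<zero>\<^bsub>M\<^esub>}"
    if "finite {i. x i \<noteq> \<zero>\<^bsub>M\<^esub>}" "finite {i. y i \<noteq> \<zero>\<^bsub>M\<^esub>}" for x y :: "'i \<Rightarrow> 'b"
    by (rule finite_subset[OF _ finite_UnI[OF that]]) auto
  have fin_smult: "finite {i. a \<odot>\<^bsub>M\<^esub> x i \<noteq> \<zero>\<^bsub>M\<^esub>}"
    if "finite {i. x i \<noteq> \<zero>\<^bsub>M\<^esub>}" "a \<in> carrier R" for a and x :: "'i \<Rightarrow> 'b"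
    by (rule finite_subset[OF _ that(1)]) (use that(2) in auto)
  have fin_neg: "finite {i. \<ominus>\<^bsub>M\<^esub> x i \<noteq> \<zero>\<^bsub>M\<^esub>}"
    if "finite {i. x i \<noteq> \<zero>\<^bsub>M\<^esub>}" for x :: "'i \<Rightarrow> 'b"
    by (rule finite_subset[OF _ that]) auto
  show ?thesis
  proof (rule moduleI)
    show "cring R" by (rule M.is_cring)
    show "abelian_group (direct_sum M A)"
    proof (rule abelian_groupI)
      fix x assume x: "x \<in> carrier (direct_sum M A)"
      then show "\<exists>y\<in>carrier (direct_sum M A). y \<oplus>\<^bsub>direct_sum M A\<^esub> x = \<zero>\<^bsub>direct_sum M A\<^esub>"
        by (intro bexI[of _ "\<lambda>i. \<ominus>\<^bsub>M\<^esub> x i"])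
          (auto simp: direct_sum_def M.l_neg fin_neg)
    qed (auto simp: direct_sum_def M.a_ac fin_add)
  qed (auto simp: direct_sum_def M.smult_l_distr M.smult_r_distr M.smult_assoc1 fin_smult)
qed

lemma module_prod_module:
  assumes "module R M" "module R N"
  shows "module R (prod_module M N)"
proof -
  interpret M: module R M by fact
  interpret N: module R N by fact
  show ?thesis
  proof (rule moduleI)
    show "cring R" by (rule M.is_cring)
    show "abelian_group (prod_module M N)"
    proof (rule abelian_groupI)
      fix x assume x: "x \<in> carrier (prod_module M N)"
      then show "\<exists>y\<in>carrier (prod_module M N). y \<oplus>\<^bsub>prod_module M N\<^esub> x = \<zero>\<^bsub>prod_module M N\<^esub>"
        by (intro bexI[of _ "(\<ominus>\<^bsub>M\<^esub> fst x, \<ominus>\<^bsub>N\<^esub> snd x)"])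
          (auto simp: prod_module_def M.l_neg N.l_neg)
    qed (auto simp: prod_module_def M.a_ac N.a_ac)
  qed (auto simp: prod_module_def M.smult_l_distr M.smult_r_distr M.smult_assoc1
      N.smult_l_distr N.smult_r_distr N.smult_assoc1)
qed

lemma carrier_direct_sum_finite:
  assumes "finite A"
  shows "carrier (direct_sum M A) = {x. (\<forall>i. x i \<in> carrier M) \<and> (\<forall>i. i \<notin> A \<longrightarrow> x i = \<zero>\<^bsub>M\<^esub>)}"
proof -
  have "finite {i. x i \<noteq> \<zero>\<^bsub>M\<^esub>}" if "\<forall>i. i \<notin> A \<longrightarrow> x i = \<zero>\<^bsub>M\<^esub>" for x
    by (rule finite_subset[OF _ assms]) (use that in auto)
  then show ?thesis by (auto simp: direct_sum_def)
qed

lemma direct_sum_simps [simp]: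
  "\<zero>\<^bsub>direct_sum M A\<^esub> = (\<lambda>i. \<zero>\<^bsub>M\<^esub>)"
  "x \<oplus>\<^bsub>direct_sum M A\<^esub> y = (\<lambda>i. x i \<oplus>\<^bsub>M\<^esub> y i)"
  "a \<odot>\<^bsub>direct_sum M A\<^esub> x = (\<lambda>i. a \<odot>\<^bsub>M\<^esub> x i)"
  by (simp_all add: direct_sum_def)


section \<open>Koszul complexes\<close>

lemma (in abelian_group) sign_add_pow:
  assumes "x \<in> carrier G"
  shows "[((- 1 :: int) ^ n)] \<cdot> x = (if even n then x else \<ominus> x)"
proof -
  have "[(1 :: int)] \<cdot> x = x"
    using assms add.int_pow_1 by simp
  moreover have "[(- 1 :: int)] \<cdot> x = \<ominus> x"
    using assms add.int_pow_neg[of x 1] by simp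
  ultimately show ?thesis by (simp add: minus_one_power_iff)
qed

lemma cobj_koszul: "cobj (koszul M f) m = direct_sum M {I. I \<subseteq> {..<length f} \<and> card I = m}"
  by (simp add: koszul_def)

lemma carrier_cobj_koszul:
  "carrier (cobj (koszul M f) m) = {x. (\<forall>I. x I \<in> carrier M) \<and>
     (\<forall>I. I \<notin> {I. I \<subseteq> {..<length f} \<and> card I = m} \<longrightarrow> x I = \<zero>\<^bsub>M\<^esub>)}"
  unfolding cobj_koszul by (rule carrier_direct_sum_finite) simp

lemma length_pow_seq [simp]: "length (pow_seq R s n) = length s"
  by (simp add: pow_seq_def)

context module
begin

text \<open>With the integer sign replaced by a choice between a term and its negative, linearity
  and compatibility with \<open>kappa\<close> can be checked summand by summand.\<close>

lemma koszul_cdiff: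
  assumes "set f \<subseteq> carrier R" "\<And>I. x I \<in> carrier M"
  shows "cdiff (koszul M f) m x J = (\<Oplus>\<^bsub>M\<^esub>i \<in> {..<length f} - J.
    if even (card {j \<in> J. j < i}) then (f ! i) \<odot>\<^bsub>M\<^esub> x (insert i J) else \<ominus>\<^bsub>M\<^esub> ((f ! i) \<odot>\<^bsub>M\<^esub> x (insert i J)))"
proof -
  have "f ! i \<in> carrier R" if "i < length f" for i
    using assms(1) that by auto
  then show ?thesis
    unfolding koszul_def
    by (auto intro!: M.finsum_cong' simp: M.sign_add_pow assms(2))
qed

lemma koszul_cdiff_hom:
  assumes f: "set f \<subseteq> carrier R"
  shows "cdiff (koszul M f) (Suc m) \<in> mod_hom R (cobj (koszul M f) (Suc m)) (cobj (koszul M f) m)"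
proof -
  have fi: "f ! i \<in> carrier R" if "i < length f" for i
    using assms(1) that by auto
  let ?t = "\<lambda>x J i. if even (card {j \<in> J. j < i}) then (f ! i) \<odot>\<^bsub>M\<^esub> x (insert i J)
    else \<ominus>\<^bsub>M\<^esub> ((f ! i) \<odot>\<^bsub>M\<^esub> x (insert i J))"
  have closed: "x I \<in> carrier M" if "x \<in> carrier (cobj (koszul M f) k)" for x k I
    using that by (auto simp: carrier_cobj_koszul)
  have tcl: "?t x J i \<in> carrier M" if "i < length f" "\<And>I. x I \<in> carrier M" for x J i
    using that by (simp add: fi)
  show ?thesis
  proof (rule mod_homI)
    fix x assume x: "x \<in> carrier (cobj (koszul M f) (Suc m))"
    \<comment> \<open>Adding a point outside J raises the size by exactly one, so a set J that is
      not an m-element set of indices never yields an (m + 1)-element one, and every summand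
      vanishes.\<close>
    have "cdiff (koszul M f) (Suc m) x J = \<zero>\<^bsub>M\<^esub>" if J: "\<not> (J \<subseteq> {..<length f} \<and> card J = m)" for J
    proof -
      have "x (insert i J) = \<zero>\<^bsub>M\<^esub>" if i: "i \<in> {..<length f} - J" for i
      proof -
        have "\<not> (insert i J \<subseteq> {..<length f} \<and> card (insert i J) = Suc m)"
        proof
          assume *: "insert i J \<subseteq> {..<length f} \<and> card (insert i J) = Suc m"
          then have "finite J" using finite_subset by auto
          with * J i show False by auto
        qed
        then show ?thesis using x by (auto simp: carrier_cobj_koszul)
      qed
      then have "(\<Oplus>\<^bsub>M\<^esub>i \<in> {..<length f} - J. ?t x J i) = (\<Oplus>\<^bsub>M\<^esub>i \<in> {..<length f} - J. \<zero>\<^bsub>M\<^esub>)"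
        by (intro M.finsum_cong') (auto simp: fi)
      then show ?thesis
        by (simp add: koszul_cdiff[OF f closed[OF x]])
    qed
    moreover have "cdiff (koszul M f) (Suc m) x J \<in> carrier M" for J
      unfolding koszul_cdiff[OF f closed[OF x]]
      using closed[OF x] by (intro M.finsum_closed) (auto simp: fi)
    ultimately show "cdiff (koszul M f) (Suc m) x \<in> carrier (cobj (koszul M f) m)"
      by (auto simp: carrier_cobj_koszul)
    fix y assume y: "y \<in> carrier (cobj (koszul M f) (Suc m))"
    have xy: "x I \<oplus>\<^bsub>M\<^esub> y I \<in> carrier M" for I
      using closed[OF x] closed[OF y] by simp
    show "cdiff (koszul M f) (Suc m) (x \<oplus>\<^bsub>cobj (koszul M f) (Suc m)\<^esub> y) =
      cdiff (koszul M f) (Suc m) x \<oplus>\<^bsub>cobj (koszul M f) m\<^esub> cdiff (koszul M f) (Suc m) y"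
    proof
      fix J
      have "(\<Oplus>\<^bsub>M\<^esub>i \<in> {..<length f} - J. ?t (\<lambda>I. x I \<oplus>\<^bsub>M\<^esub> y I) J i)
        = (\<Oplus>\<^bsub>M\<^esub>i \<in> {..<length f} - J. ?t x J i \<oplus>\<^bsub>M\<^esub> ?t y J i)"
        using closed[OF x] closed[OF y]
        by (intro M.finsum_cong') (auto simp: fi smult_r_distr M.minus_add)
      also have "\<dots> = (\<Oplus>\<^bsub>M\<^esub>i \<in> {..<length f} - J. ?t x J i) \<oplus>\<^bsub>M\<^esub> (\<Oplus>\<^bsub>M\<^esub>i \<in> {..<length f} - J. ?t y J i)"
        using closed[OF x] closed[OF y] by (intro M.finsum_addf) (auto simp: fi)
      finally show "cdiff (koszul M f) (Suc m) (x \<oplus>\<^bsub>cobj (koszul M f) (Suc m)\<^esub> y) J =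
        (cdiff (koszul M f) (Suc m) x \<oplus>\<^bsub>cobj (koszul M f) m\<^esub> cdiff (koszul M f) (Suc m) y) J"
        by (simp add: cobj_koszul koszul_cdiff[OF f] closed[OF x] closed[OF y] xy)
    qed
  next
    fix a x assume a: "a \<in> carrier R" and x: "x \<in> carrier (cobj (koszul M f) (Suc m))"
    show "cdiff (koszul M f) (Suc m) (a \<odot>\<^bsub>cobj (koszul M f) (Suc m)\<^esub> x) =
      a \<odot>\<^bsub>cobj (koszul M f) m\<^esub> cdiff (koszul M f) (Suc m) x"
    proof
      fix J
      have "(\<Oplus>\<^bsub>M\<^esub>i \<in> {..<length f} - J. ?t (\<lambda>I. a \<odot>\<^bsub>M\<^esub> x I) J i)
        = (\<Oplus>\<^bsub>M\<^esub>i \<in> {..<length f} - J. a \<odot>\<^bsub>M\<^esub> ?t x J i)"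
        using closed[OF x] a
        by (intro M.finsum_cong')
          (auto simp: fi smult_r_minus R.m_comm smult_assoc1[symmetric])
      also have "\<dots> = a \<odot>\<^bsub>M\<^esub> (\<Oplus>\<^bsub>M\<^esub>i \<in> {..<length f} - J. ?t x J i)"
        using closed[OF x] a by (intro finsum_smult_ldistr[symmetric]) (auto simp: fi)
      finally show "cdiff (koszul M f) (Suc m) (a \<odot>\<^bsub>cobj (koszul M f) (Suc m)\<^esub> x) J =
        (a \<odot>\<^bsub>cobj (koszul M f) m\<^esub> cdiff (koszul M f) (Suc m) x) J"
        using a by (simp add: cobj_koszul koszul_cdiff[OF f] closed[OF x])
    qed
  qed
qed

section \<open>The comparison maps \<open>kappa\<close>\<close>

lemma list_prod_closed:
  assumes "set s \<subseteq> carrier R" "I \<subseteq> {..<length s}"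
  shows "(\<Otimes>i\<in>I. s ! i) \<in> carrier R"
  using assms nth_mem by (intro R.finprod_closed) fastforce

text \<open>The modules of a Koszul complex depend on the sequence only through its length, so the
  exponents \<open>n'\<close> and \<open>k'\<close> of source and target are free here.\<close>

lemma kappa_hom:
  assumes s: "set s \<subseteq> carrier R"
  shows "kappa R M s n k m \<in> mod_hom R (cobj (koszul M (pow_seq R s n')) i) (cobj (koszul M (pow_seq R s k')) i)"
proof -
  have p: "(\<Otimes>i\<in>I. s ! i) [^] (n - k) \<in> carrier R" if "I \<subseteq> {..<length s}" for I
    by (intro R.nat_pow_closed list_prod_closed s that)
  let ?B = "{I. I \<subseteq> {..<length s} \<and> card I = i}"
  have carrier: "carrier (direct_sum M ?B) = {x. (\<forall>I. x I \<in> carrier M) \<and> (\<forall>I. I \<notin> ?B \<longrightarrow> x I = \<zero>\<^bsub>M\<^esub>)}"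
    by (rule carrier_direct_sum_finite) simp
  show ?thesis
    unfolding cobj_koszul length_pow_seq
    by (rule mod_homI)
      (auto simp: carrier kappa_def p smult_r_distr R.m_comm smult_assoc1[symmetric] fun_eq_iff)
qed

text \<open>The exponents of the coefficients add up: (k - j) + (n - k) = n - j. One formula defines
  \<open>kappa\<close> in all degrees, hence the independent degree arguments.\<close>

lemma kappa_comp:
  assumes s: "set s \<subseteq> carrier R" and le: "j \<le> k" "k \<le> n" and x: "\<And>I. x I \<in> carrier M"
  shows "kappa R M s k j m (kappa R M s n k m' x) = kappa R M s n j m'' x"
proof
  fix I
  show "kappa R M s k j m (kappa R M s n k m' x) I = kappa R M s n j m'' x I"
  proof (cases "I \<subseteq> {..<length s}")
    case True
    then have p: "(\<Otimes>i\<in>I. s ! i) \<in> carrier R"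
      by (rule list_prod_closed[OF s])
    have "(k - j) + (n - k) = n - j" using le by simp
    with True p x show ?thesis
      by (simp add: kappa_def smult_assoc1[symmetric] R.nat_pow_mult)
  qed (simp add: kappa_def)
qed

text \<open>Let s_J be the product of the s_i with i in J. The coefficients agree because s_j^k (s_j
  s_J)^(n-k) = s_J^(n-k) s_j^n for j outside J; the signs on both sides are the same.\<close>

lemma kappa_commutes:
  assumes s: "set s \<subseteq> carrier R" and le: "k \<le> n"
    and x: "x \<in> carrier (cobj (koszul M (pow_seq R s n)) (Suc i))"
  shows "kappa R M s n k m (cdiff (koszul M (pow_seq R s n)) (Suc i) x) =
    cdiff (koszul M (pow_seq R s k)) (Suc i) (kappa R M s n k m' x)"
proof
  fix J
  have ps: "set (pow_seq R s n) \<subseteq> carrier R" for n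
    using s by (auto simp: pow_seq_def)
  have si: "s ! i \<in> carrier R" if "i < length s" for i
    using s that by auto
  have nth: "pow_seq R s n ! i = s ! i [^] n" if "i < length s" for i n
    using that by (simp add: pow_seq_def)
  have xc: "x I \<in> carrier M" for I
    using x by (auto simp: carrier_cobj_koszul)
  have kc: "kappa R M s n k m' x \<in> carrier (cobj (koszul M (pow_seq R s k)) (Suc i))"
    by (rule mod_hom_closed[OF kappa_hom[OF s] x])
  then have kx: "kappa R M s n k m' x I \<in> carrier M" for I
    by (auto simp: carrier_cobj_koszul)
  let ?e = "\<lambda>J. (\<Otimes>i\<in>J. s ! i) [^] (n - k)"
  let ?t = "\<lambda>n x J i. if even (card {j \<in> J. j < i}) then (s ! i [^] (n :: nat)) \<odot>\<^bsub>M\<^esub> x (insert i J)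
    else \<ominus>\<^bsub>M\<^esub> ((s ! i [^] n) \<odot>\<^bsub>M\<^esub> x (insert i J))"
  show "kappa R M s n k m (cdiff (koszul M (pow_seq R s n)) (Suc i) x) J =
    cdiff (koszul M (pow_seq R s k)) (Suc i) (kappa R M s n k m' x) J"
  proof (cases "J \<subseteq> {..<length s}")
    case True
    then have fin: "finite J" using finite_subset by blast
    have e: "(\<Otimes>i\<in>J. s ! i) \<in> carrier R"
      by (rule list_prod_closed[OF s True])
    have step: "(s ! j [^] k) \<odot>\<^bsub>M\<^esub> kappa R M s n k m' x (insert j J) = ?e J \<odot>\<^bsub>M\<^esub> ((s ! j [^] n) \<odot>\<^bsub>M\<^esub> x (insert j J))"
      if j: "j \<in> {..<length s} - J" for j
    proof -
      have sj: "s ! j \<in> carrier R" using j si by auto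
      have "(\<Otimes>i\<in>insert j J. s ! i) = s ! j \<otimes> (\<Otimes>i\<in>J. s ! i)"
        using j True si fin by (intro R.finprod_insert) auto
      then have "(\<Otimes>i\<in>insert j J. s ! i) [^] (n - k) = s ! j [^] (n - k) \<otimes> ?e J"
        using sj e by (simp add: R.nat_pow_distrib)
      then have "s ! j [^] k \<otimes> (\<Otimes>i\<in>insert j J. s ! i) [^] (n - k) = (s ! j [^] k \<otimes> s ! j [^] (n - k)) \<otimes> ?e J"
        using sj e by (simp add: R.m_assoc)
      also have "\<dots> = ?e J \<otimes> s ! j [^] n"
        using sj e le by (simp add: R.nat_pow_mult R.m_comm)
      finally have eq: "s ! j [^] k \<otimes> (\<Otimes>i\<in>insert j J. s ! i) [^] (n - k) = ?e J \<otimes> s ! j [^] n" .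
      have "(\<Otimes>i\<in>insert j J. s ! i) \<in> carrier R"
        using True j by (intro list_prod_closed s) auto
      then show ?thesis
        using True j sj e xc by (simp add: kappa_def smult_assoc1[symmetric] eq)
    qed
    have "kappa R M s n k m (cdiff (koszul M (pow_seq R s n)) (Suc i) x) J
      = ?e J \<odot>\<^bsub>M\<^esub> (\<Oplus>\<^bsub>M\<^esub>j \<in> {..<length s} - J. ?t n x J j)"
      using True unfolding kappa_def koszul_cdiff[OF ps xc]
      by (auto intro!: arg_cong[of _ _ "\<lambda>z. _ \<odot>\<^bsub>M\<^esub> z"] M.finsum_cong' simp: nth si xc)
    also have "\<dots> = (\<Oplus>\<^bsub>M\<^esub>j \<in> {..<length s} - J. ?e J \<odot>\<^bsub>M\<^esub> ?t n x J j)"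
      using e xc by (intro finsum_smult_ldistr) (auto simp: si)
    also have "\<dots> = (\<Oplus>\<^bsub>M\<^esub>j \<in> {..<length s} - J. ?t k (kappa R M s n k m' x) J j)"
      using e xc kx step by (intro M.finsum_cong') (auto simp: si smult_r_minus)
    also have "\<dots> = cdiff (koszul M (pow_seq R s k)) (Suc i) (kappa R M s n k m' x) J"
      unfolding koszul_cdiff[OF ps kx]
      by (auto intro!: M.finsum_cong' simp: nth si kx)
    finally show ?thesis .
  next
    case False
    have "cdiff (koszul M (pow_seq R s k)) (Suc i) (kappa R M s n k m' x) \<in> carrier (cobj (koszul M (pow_seq R s k)) i)"
      by (rule mod_hom_closed[OF koszul_cdiff_hom[OF ps] kc])
    with False show ?thesis by (simp add: kappa_def carrier_cobj_koszul)
  qed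
qed

section \<open>Lifting cycles and extending the map over generators\<close>

text \<open>This turns vanishing on homology, a statement about cosets, into one about elements: a
  cycle acquires a preimage under the differential. It also passes from the exponent h + v d to
  every larger n, since \<open>kappa\<close> from n to v factors through that exponent.\<close>

lemma kappa_cycle_boundary:
  assumes kh: "kills_homology R M s h" and s: "set s \<subseteq> carrier R" and ne: "s \<noteq> []" and v: "v \<ge> 1" and i: "i \<ge> 1"
    and n: "n \<ge> h + v * length s"
    and z: "z \<in> carrier (cobj (koszul M (pow_seq R s n)) i)"
    and dz: "cdiff (koszul M (pow_seq R s n)) i z = \<zero>\<^bsub>cobj (koszul M (pow_seq R s n)) (i - 1)\<^esub>"
  shows "\<exists>y\<in>carrier (cobj (koszul M (pow_seq R s v)) (Suc i)).
    cdiff (koszul M (pow_seq R s v)) (Suc i) y = kappa R M s n v m z"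
proof -
  obtain i' where i': "i = Suc i'" using i by (cases i) auto
  let ?N = "h + v * length s"
  let ?K = "koszul M (pow_seq R s ?N)" and ?L = "koszul M (pow_seq R s v)"
  have ps: "set (pow_seq R s n) \<subseteq> carrier R" for n
    using s by (auto simp: pow_seq_def)
  have mod: "module R (cobj (koszul M f) j)" for f j
    unfolding cobj_koszul by (rule module_direct_sum[OF module_axioms])
  interpret K: module R "cobj ?K i" by (rule mod)
  interpret L: module R "cobj ?L i" by (rule mod)
  \<comment> \<open>The hypothesis on homology concerns the exponent \<open>?N\<close> itself, so
    the cycle is first moved there.\<close>
  define w where "w = kappa R M s n ?N i z"
  have w: "w \<in> carrier (cobj ?K i)"
    unfolding w_def by (rule mod_hom_closed[OF kappa_hom[OF s] z])
  have "cdiff ?K i w = kappa R M s n ?N 0 (cdiff (koszul M (pow_seq R s n)) i z)"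
    using kappa_commutes[OF s n, of z i' 0 i] z by (simp add: w_def i')
  also have "\<dots> = \<zero>\<^bsub>cobj ?K (i - 1)\<^esub>"
    unfolding dz cobj_koszul length_pow_seq
    by (rule mod_hom_zero[OF module_direct_sum[OF module_axioms] module_direct_sum[OF module_axioms]
          kappa_hom[OF s, unfolded cobj_koszul length_pow_seq]])
  finally have wc: "w \<in> cycles ?K i"
    using i w by (simp add: cycles_def a_kernel_def kernel_def)
  let ?c = "boundaries ?K i +>\<^bsub>(cobj ?K i)\<lparr>carrier := cycles ?K i\<rparr>\<^esub> w"
  have "?c \<in> carrier (homology ?K i)"
    using wc by (auto simp: homology_def A_FactGroup_def FactGroup_def A_RCOSETS_defs a_r_coset_def)
  then have hm: "homology_map ?L (kappa R M s ?N v) i ?c = \<one>\<^bsub>homology ?L i\<^esub>"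
    using kh v i unfolding kills_homology_def by blast
  \<comment> \<open>As zero is a boundary, every coset contains its representative: \<open>w\<close>
    lies in its class, and its image lies in the image class, which is the set of
    boundaries.\<close>
  have zb: "\<zero>\<^bsub>cobj (koszul M (pow_seq R s n)) i\<^esub> \<in> boundaries (koszul M (pow_seq R s n)) i" for n
    unfolding boundaries_def
    using mod_hom_zero[OF mod mod koszul_cdiff_hom[OF ps]] abelian_groupE(2)[OF module.axioms(2)[OF mod]]
    by (metis image_eqI)
  have kw: "kappa R M s ?N v i w \<in> carrier (cobj ?L i)"
    by (rule mod_hom_closed[OF kappa_hom[OF s] w])
  have "w \<in> ?c"
    using zb w by (force simp: a_r_coset_def r_coset_def)
  moreover have "kappa R M s ?N v i w \<in> boundaries ?L i +>\<^bsub>cobj ?L i\<^esub> kappa R M s ?N v i w"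
    using zb kw by (force simp: a_r_coset_def r_coset_def)
  ultimately have "kappa R M s ?N v i w \<in> homology_map ?L (kappa R M s ?N v) i ?c"
    by (auto simp: homology_map_def)
  then have "kappa R M s ?N v i w \<in> boundaries ?L i"
    by (simp add: hm homology_def A_FactGroup_def FactGroup_def)
  moreover have "kappa R M s ?N v i w = kappa R M s n v m z"
  proof (unfold w_def, rule kappa_comp[OF s])
    \<comment> \<open>For nonempty \<open>s\<close> one has v <= v d; for the empty sequence
      \<open>?N\<close> is only h.\<close>
    show "v \<le> ?N" using ne by (cases s) auto
  qed (use n z in \<open>auto simp: carrier_cobj_koszul\<close>)
  ultimately show ?thesis
    unfolding boundaries_def by force
qed


text \<open>The map is \<open>kappa (q x) + \<Sum>j. c j x y j\<close>. The values \<open>y i j\<close> are chosen by induction on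
  the degree \<open>i\<close>: before each choice everything constructed so far is composed with a \<open>kappa\<close> that
  kills homology, so that the cycle to be lifted becomes a boundary. With \<open>d = length s\<close>, each of the
  degrees \<open>2, \<dots>, d + 1\<close>
  costs one such composition; in degree \<open>d + 1\<close> the lift is zero, and its existence says that the
  cycles of degree \<open>d\<close> are mapped to zero.\<close>

lemma chain_map_into_koszul:
  fixes C :: "('a, 'x) chain_cx"
  assumes kh: "kills_homology R M s h" and s: "set s \<subseteq> carrier R" and r: "r \<ge> 1"
    and u: "u = u_exp (length s) h l r"
    and C: "\<And>i. module R (cobj C i)"
    and A: "\<And>i. finite (A i)" "A 0 = {}" "A (Suc 0) = {}"
    and q: "\<And>i. q i \<in> mod_hom R (cobj C i) (cobj (koszul M (pow_seq R s u)) i)"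
    and c: "\<And>i j. j \<in> A i \<Longrightarrow> c i j \<in> mod_hom R (cobj C i) (ring_module R)"
    and w: "\<And>i x. x \<in> carrier (cobj C (Suc i)) \<Longrightarrow> w i x \<in> carrier (cobj C i)"
    and qw: "\<And>i x. x \<in> carrier (cobj C (Suc i)) \<Longrightarrow>
      q i (w i x) = cdiff (koszul M (pow_seq R s u)) (Suc i) (q (Suc i) x)"
    and cw: "\<And>i j x. x \<in> carrier (cobj C (Suc i)) \<Longrightarrow> j \<in> A i \<Longrightarrow> c i j (w i x) = \<zero>"
    and b: "\<And>i j. j \<in> A (Suc i) \<Longrightarrow> b i j \<in> cycles C i"
    and d: "\<And>i x. x \<in> carrier (cobj C (Suc i)) \<Longrightarrow>
      cdiff C (Suc i) x = w i x \<oplus>\<^bsub>cobj C i\<^esub> (\<Oplus>\<^bsub>cobj C i\<^esub>j\<in>A (Suc i). c (Suc i) j x \<odot>\<^bsub>cobj C i\<^esub> b i j)"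
  shows "\<exists>\<phi>. chain_map R C (koszul M (pow_seq R s r)) \<phi> \<and>
    (\<forall>i. \<forall>x\<in>carrier (cobj C i). (\<forall>j\<in>A i. c i j x = \<zero>) \<longrightarrow> \<phi> i x = kappa R M s u r i (q i x))"
proof -
  let ?n = "length s"
  \<comment> \<open>Every exponent gives the same modules, with different differentials;
    \<open>K\<close> is this common family of modules.\<close>
  define K where "K = (\<lambda>i. direct_sum M {I. I \<subseteq> {..<?n} \<and> card I = i})"
  define \<delta> where "\<delta> = (\<lambda>v. cdiff (koszul M (pow_seq R s v)))"
  define \<kappa> where "\<kappa> = (\<lambda>n v. kappa R M s n v 0)"
  have kappa_eq: "kappa R M s n v i = \<kappa> n v" for n v i
    by (simp add: \<kappa>_def kappa_def fun_eq_iff)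
  have cobj: "cobj (koszul M (pow_seq R s v)) i = K i" for v i
    by (simp add: K_def cobj_koszul)
  have ps: "set (pow_seq R s v) \<subseteq> carrier R" for v
    using s by (auto simp: pow_seq_def)
  interpret C: module R "cobj C i" for i by (rule C)
  interpret K: module R "K i" for i
    unfolding K_def by (rule module_direct_sum[OF module_axioms])
  have \<delta>: "\<delta> v (Suc i) \<in> mod_hom R (K (Suc i)) (K i)" for v i
    using koszul_cdiff_hom[OF ps] unfolding cobj \<delta>_def .
  have \<kappa>: "\<kappa> n v \<in> mod_hom R (K i) (K i)" for n v i
    using kappa_hom[OF s] unfolding cobj kappa_eq .
  have \<kappa>\<delta>: "\<kappa> n v (\<delta> n (Suc i) x) = \<delta> v (Suc i) (\<kappa> n v x)" if "v \<le> n" "x \<in> carrier (K (Suc i))" for n v i x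
    using kappa_commutes[OF s that(1)] that(2) unfolding cobj kappa_eq \<delta>_def by blast
  have \<kappa>\<kappa>: "\<kappa> v v' (\<kappa> n v x) = \<kappa> n v' x" if "v' \<le> v" "v \<le> n" "x \<in> carrier (K i)" for n v v' x i
    unfolding \<kappa>_def by (rule kappa_comp[OF s that(1,2)]) (use that(3) in \<open>auto simp: K_def direct_sum_def\<close>)
  have q: "q i \<in> mod_hom R (cobj C i) (K i)" for i
    using q unfolding cobj .
  have bC: "b i j \<in> carrier (cobj C i)" if "j \<in> A (Suc i)" for i j
    using b[OF that] by (auto simp: cycles_def a_kernel_def kernel_def split: if_splits)
  have db: "cdiff C (Suc i) (b (Suc i) j) = \<zero>\<^bsub>cobj C i\<^esub>" if "j \<in> A (Suc (Suc i))" for i j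
    using b[OF that] by (auto simp: cycles_def a_kernel_def kernel_def)
  have cR: "c i j x \<in> carrier R" if "j \<in> A i" "x \<in> carrier (cobj C i)" for i j x
    using mod_hom_closed[OF c] that by simp

  \<comment> \<open>The general candidate in degree i with target exponent v: \<open>kappa\<close>
    on the Koszul part, and the j-th generator sent to \<open>y j\<close>. All that remains to be
    found are the values \<open>y\<close>.\<close>
  define \<phi> where "\<phi> = (\<lambda>v i y x. \<kappa> u v (q i x) \<oplus>\<^bsub>K i\<^esub> (\<Oplus>\<^bsub>K i\<^esub>j\<in>A i. c i j x \<odot>\<^bsub>K i\<^esub> y j))"
  have \<phi>: "\<phi> v i y \<in> mod_hom R (cobj C i) (K i)" if "y \<in> A i \<rightarrow> carrier (K i)" for v i y
    unfolding \<phi>_def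
    by (intro mod_hom_add_maps K.module_axioms mod_hom_comp[OF q \<kappa>]
        mod_hom_linear_combination[OF K.module_axioms] A that c)
  have \<phi>_zero_coords: "\<phi> v i y x = \<kappa> u v (q i x)"
    if y: "y \<in> A i \<rightarrow> carrier (K i)" and x: "x \<in> carrier (cobj C i)" and "\<forall>j\<in>A i. c i j x = \<zero>" for v i y x
  proof -
    have "(\<Oplus>\<^bsub>K i\<^esub>j\<in>A i. c i j x \<odot>\<^bsub>K i\<^esub> y j) = (\<Oplus>\<^bsub>K i\<^esub>j\<in>A i. \<zero>\<^bsub>K i\<^esub>)"
      using that by (intro K.finsum_cong') (auto simp: Pi_iff)
    then show ?thesis
      using mod_hom_closed[OF mod_hom_comp[OF q \<kappa>] x] by (simp add: \<phi>_def)
  qed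
  have \<phi>_cong: "\<phi> v i y x = \<phi> v i y' x"
    if "y \<in> A i \<rightarrow> carrier (K i)" "\<And>j. j \<in> A i \<Longrightarrow> y j = y' j" "x \<in> carrier (cobj C i)" for v i y y' x
    unfolding \<phi>_def
    by (intro arg_cong[of _ _ "\<lambda>z. _ \<oplus>\<^bsub>K i\<^esub> z"] K.finsum_cong') (use that in \<open>auto simp: cR Pi_iff\<close>)
  \<comment> \<open>It is enough to test the chain condition on the generators. The remaining part
    \<open>w i x\<close> of the boundary has zero coordinates, so \<phi> acts on it as
    \<open>kappa\<close> after \<open>q\<close>, which commutes with the differentials.\<close>
  have \<phi>_chain: "\<delta> v (Suc i) (\<phi> v (Suc i) y' x) = \<phi> v i y (cdiff C (Suc i) x)"
    if v: "v \<le> u" and y: "y \<in> A i \<rightarrow> carrier (K i)" and y': "y' \<in> A (Suc i) \<rightarrow> carrier (K (Suc i))"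
      and eq: "\<And>j. j \<in> A (Suc i) \<Longrightarrow> \<delta> v (Suc i) (y' j) = \<phi> v i y (b i j)"
      and x: "x \<in> carrier (cobj C (Suc i))" for v i y y' x
  proof -
    let ?c = "\<lambda>j. c (Suc i) j x"
    have qx: "q (Suc i) x \<in> carrier (K (Suc i))"
      by (rule mod_hom_closed[OF q x])
    have \<phi>b: "\<phi> v i y (b i j) \<in> carrier (K i)" if "j \<in> A (Suc i)" for j
      by (rule mod_hom_closed[OF \<phi>[OF y] bC[OF that]])
    have "\<delta> v (Suc i) (\<phi> v (Suc i) y' x) =
      \<delta> v (Suc i) (\<kappa> u v (q (Suc i) x)) \<oplus>\<^bsub>K i\<^esub> \<delta> v (Suc i) (\<Oplus>\<^bsub>K (Suc i)\<^esub>j\<in>A (Suc i). ?c j \<odot>\<^bsub>K (Suc i)\<^esub> y' j)"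
      unfolding \<phi>_def using y' x
      by (intro mod_hom_add[OF \<delta>] mod_hom_closed[OF \<kappa> qx] K.finsum_closed) (auto simp: cR Pi_iff)
    also have "\<delta> v (Suc i) (\<Oplus>\<^bsub>K (Suc i)\<^esub>j\<in>A (Suc i). ?c j \<odot>\<^bsub>K (Suc i)\<^esub> y' j)
      = (\<Oplus>\<^bsub>K i\<^esub>j\<in>A (Suc i). \<delta> v (Suc i) (?c j \<odot>\<^bsub>K (Suc i)\<^esub> y' j))"
      using y' x by (intro mod_hom_finsum[OF K.module_axioms K.module_axioms \<delta> A(1)]) (auto simp: cR Pi_iff)
    also have "\<dots> = (\<Oplus>\<^bsub>K i\<^esub>j\<in>A (Suc i). \<phi> v i y (?c j \<odot>\<^bsub>cobj C i\<^esub> b i j))"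
      using y' x \<phi>b
      by (intro K.finsum_cong')
        (auto simp: cR Pi_iff eq bC mod_hom_smult[OF \<delta>] mod_hom_smult[OF \<phi>[OF y]])
    also have "\<dots> = \<phi> v i y (\<Oplus>\<^bsub>cobj C i\<^esub>j\<in>A (Suc i). ?c j \<odot>\<^bsub>cobj C i\<^esub> b i j)"
      using x by (intro mod_hom_finsum[OF C K.module_axioms \<phi>[OF y] A(1), symmetric]) (auto simp: cR bC)
    also have "\<delta> v (Suc i) (\<kappa> u v (q (Suc i) x)) = \<phi> v i y (w i x)"
      using \<phi>_zero_coords[OF y w[OF x]] cw[OF x] \<kappa>\<delta>[OF v qx] qw[OF x] by (simp add: \<delta>_def)
    also have "\<phi> v i y (w i x) \<oplus>\<^bsub>K i\<^esub> \<phi> v i y (\<Oplus>\<^bsub>cobj C i\<^esub>j\<in>A (Suc i). ?c j \<odot>\<^bsub>cobj C i\<^esub> b i j)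
      = \<phi> v i y (cdiff C (Suc i) x)"
      unfolding d[OF x] using x
      by (intro mod_hom_add[OF \<phi>[OF y], symmetric] w C.finsum_closed) (auto simp: cR bC)
    finally show ?thesis .
  qed
  \<comment> \<open>Lowering the exponent of a candidate again gives a candidate, with its values
    pushed forward, so earlier choices survive a passage.\<close>
  have \<phi>_\<kappa>: "\<kappa> v v' (\<phi> v i y x) = \<phi> v' i (\<lambda>j. \<kappa> v v' (y j)) x"
    if v: "v' \<le> v" "v \<le> u" and y: "y \<in> A i \<rightarrow> carrier (K i)" and x: "x \<in> carrier (cobj C i)" for v v' i y x
  proof -
    have qx: "q i x \<in> carrier (K i)" by (rule mod_hom_closed[OF q x])
    have "\<kappa> v v' (\<phi> v i y x) = \<kappa> v v' (\<kappa> u v (q i x)) \<oplus>\<^bsub>K i\<^esub> \<kappa> v v' (\<Oplus>\<^bsub>K i\<^esub>j\<in>A i. c i j x \<odot>\<^bsub>K i\<^esub> y j)"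
      unfolding \<phi>_def using y x
      by (intro mod_hom_add[OF \<kappa>] mod_hom_closed[OF \<kappa> qx] K.finsum_closed) (auto simp: cR Pi_iff)
    also have "\<kappa> v v' (\<Oplus>\<^bsub>K i\<^esub>j\<in>A i. c i j x \<odot>\<^bsub>K i\<^esub> y j) = (\<Oplus>\<^bsub>K i\<^esub>j\<in>A i. \<kappa> v v' (c i j x \<odot>\<^bsub>K i\<^esub> y j))"
      using y x by (intro mod_hom_finsum[OF K.module_axioms K.module_axioms \<kappa> A(1)]) (auto simp: cR Pi_iff)
    also have "\<dots> = (\<Oplus>\<^bsub>K i\<^esub>j\<in>A i. c i j x \<odot>\<^bsub>K i\<^esub> \<kappa> v v' (y j))"
      using y x by (intro K.finsum_cong') (auto simp: cR Pi_iff mod_hom_smult[OF \<kappa>] mod_hom_closed[OF \<kappa>])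
    finally show ?thesis
      by (simp add: \<kappa>\<kappa>[OF v qx] \<phi>_def)
  qed

  \<comment> \<open>\<open>U m\<close> is the exponent required when m passages are still to come;
    the recursion \<open>U_Suc\<close> is the cost of one passage.\<close>
  define U where "U = (\<lambda>m. (h + l) * (\<Sum>j<m. ?n ^ j) + r * ?n ^ m)"
  have U_Suc: "U (Suc m) = h + l + ?n * U m" for m
  proof -
    have "(\<Sum>j<Suc m. ?n ^ j) = 1 + ?n * (\<Sum>j<m. ?n ^ j)"
      by (simp add: sum.lessThan_Suc_shift sum_distrib_left del: sum.lessThan_Suc)
    then show ?thesis by (simp add: U_def algebra_simps del: sum.lessThan_Suc)
  qed
  have U_0: "U 0 = r" by (simp add: U_def)
  have U_n: "U ?n = u" by (simp add: u u_exp_def U_def)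
  have U_le: "U m \<le> u" if "m \<le> ?n" for m
  proof (cases "s = []")
    case False
    then have "U m' \<le> U (Suc m')" for m'
      unfolding U_Suc by (cases s) auto
    then show ?thesis
      using that lift_Suc_mono_le[of U m ?n] U_n by simp
  qed (use that U_n in simp)
  have U_pos: "U m \<ge> 1" if "s \<noteq> []" for m
  proof -
    have "r * ?n ^ m > 0" using r that by simp
    then show ?thesis unfolding U_def by linarith
  qed

  \<comment> \<open>After k passages the target exponent is \<open>U (?n - k)\<close>. Values are
    chosen in degrees up to k + 1, and the chain condition holds on all generators of these
    degrees.\<close>
  have stage: "\<exists>y. (\<forall>i\<le>Suc k. y i \<in> A i \<rightarrow> carrier (K i)) \<and>
    (\<forall>i\<le>k. \<forall>j\<in>A (Suc i). \<delta> (U (?n - k)) (Suc i) (y (Suc i) j) = \<phi> (U (?n - k)) i (y i) (b i j))"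
    if "k \<le> ?n" for k
    using that
  proof (induction k)
    case 0
    show ?case
      \<comment> \<open>There are no generators in degrees 0 and 1, so any values do; zero is a
        default.\<close>
      by (rule exI[of _ "\<lambda>i j. \<zero>\<^bsub>K i\<^esub>"]) (use A in auto)
  next
    case (Suc k)
    define v where "v = U (?n - k)"
    define v' where "v' = U (?n - Suc k)"
    have ne: "s \<noteq> []" using Suc.prems by auto
    have v_eq: "v = h + l + ?n * v'"
      unfolding v_def v'_def using U_Suc[of "?n - Suc k"] Suc.prems by (simp add: Suc_diff_Suc)
    have vu: "v \<le> u" unfolding v_def by (rule U_le) simp
    have vv: "v' \<le> v" unfolding v_eq using ne by (cases s) auto
    obtain y where y: "\<And>i. i \<le> Suc k \<Longrightarrow> y i \<in> A i \<rightarrow> carrier (K i)"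
      and \<delta>y: "\<And>i j. i \<le> k \<Longrightarrow> j \<in> A (Suc i) \<Longrightarrow> \<delta> v (Suc i) (y (Suc i) j) = \<phi> v i (y i) (b i j)"
      using Suc.IH[OF Suc_leD[OF Suc.prems]] unfolding v_def[symmetric] by blast
    have "\<exists>Y\<in>carrier (K (Suc (Suc k))). \<delta> v' (Suc (Suc k)) Y = \<kappa> v v' (\<phi> v (Suc k) (y (Suc k)) (b (Suc k) j))"
      if j: "j \<in> A (Suc (Suc k))" for j
    proof -
      let ?z = "\<phi> v (Suc k) (y (Suc k)) (b (Suc k) j)"
      have z: "?z \<in> carrier (K (Suc k))"
        by (rule mod_hom_closed[OF \<phi> bC[OF j]]) (use y in auto)
      \<comment> \<open>The image of the cycle \<open>b (Suc k) j\<close> is a cycle because the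
        candidate already satisfies the chain condition one degree lower.\<close>
      have "\<delta> v (Suc k) ?z = \<phi> v k (y k) (cdiff C (Suc k) (b (Suc k) j))"
        by (rule \<phi>_chain[OF vu _ _ _ bC[OF j]]) (use y \<delta>y in auto)
      also have "\<dots> = \<zero>\<^bsub>K k\<^esub>"
        unfolding db[OF j] by (rule mod_hom_zero[OF C K.module_axioms \<phi>]) (use y in auto)
      finally have dz: "\<delta> v (Suc k) ?z = \<zero>\<^bsub>K k\<^esub>" .
      \<comment> \<open>These are the bounds under which the passage from v to v' makes the cycle
        \<open>?z\<close> a boundary.\<close>
      have "v' \<ge> 1" "v \<ge> h + v' * ?n"
        by (simp_all add: v'_def U_pos[OF ne, simplified] v_eq)
      from kappa_cycle_boundary[OF kh s ne this(1) _ this(2), of "Suc k" ?z] z dz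
      show ?thesis
        by (simp add: cobj kappa_eq \<delta>_def)
    qed
    then obtain Y where Y: "\<And>j. j \<in> A (Suc (Suc k)) \<Longrightarrow> Y j \<in> carrier (K (Suc (Suc k)))"
      "\<And>j. j \<in> A (Suc (Suc k)) \<Longrightarrow>
        \<delta> v' (Suc (Suc k)) (Y j) = \<kappa> v v' (\<phi> v (Suc k) (y (Suc k)) (b (Suc k) j))"
      by metis
    \<comment> \<open>The preimages just found serve in the new degree k + 2; the other values are
      carried along by \<open>kappa\<close>.\<close>
    define y' where "y' = (\<lambda>i. if i = Suc (Suc k) then Y else (\<lambda>j. \<kappa> v v' (y i j)))"
    have low: "\<delta> v' (Suc i) (y' (Suc i) j) = \<phi> v' i (y' i) (b i j)" if i: "i \<le> Suc k" and j: "j \<in> A (Suc i)" for i j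
    proof -
      have yi: "y i \<in> A i \<rightarrow> carrier (K i)" using y i by auto
      have "\<delta> v' (Suc i) (y' (Suc i) j) = \<kappa> v v' (\<phi> v i (y i) (b i j))"
      proof (cases "i = Suc k")
        case True
        with j Y show ?thesis by (simp add: y'_def)
      next
        case False
        with i have i: "i \<le> k" by simp
        then have "y (Suc i) j \<in> carrier (K (Suc i))" using y[of "Suc i"] j by auto
        from \<kappa>\<delta>[OF vv this] show ?thesis
          using \<delta>y[OF i j] i by (simp add: y'_def)
      qed
      also have "\<dots> = \<phi> v' i (y' i) (b i j)"
        using i by (simp add: \<phi>_\<kappa>[OF vv vu yi bC[OF j]] y'_def)
      finally show ?thesis .
    qed
    have "y' i \<in> A i \<rightarrow> carrier (K i)" if "i \<le> Suc (Suc k)" for i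
      using that y[of i] Y(1) mod_hom_closed[OF \<kappa>] by (auto simp: y'_def Pi_iff)
    with low show ?case unfolding v'_def[symmetric] by blast
  qed
  obtain y where y: "\<And>i. i \<le> Suc ?n \<Longrightarrow> y i \<in> A i \<rightarrow> carrier (K i)"
    and \<delta>y: "\<And>i j. i \<le> ?n \<Longrightarrow> j \<in> A (Suc i) \<Longrightarrow> \<delta> r (Suc i) (y (Suc i) j) = \<phi> r i (y i) (b i j)"
    using stage[of ?n, OF order_refl] unfolding diff_self_eq_0 U_0 by blast
  \<comment> \<open>Above degree \<open>?n\<close> + 1 the target is zero, and so are the
    values.\<close>
  define Y where "Y = (\<lambda>i. if i \<le> Suc ?n then y i else (\<lambda>j. \<zero>\<^bsub>K i\<^esub>))"
  have Y: "Y i \<in> A i \<rightarrow> carrier (K i)" for i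
    using y[of i] by (auto simp: Y_def)
  have trivial: "x = z" if "i > ?n" "x \<in> carrier (K i)" "z \<in> carrier (K i)" for i x z
  proof -
    have "\<not> (I \<subseteq> {..<?n} \<and> card I = i)" for I
      using that(1) card_mono[of "{..<?n}" I] by auto
    then show ?thesis using that(2,3) by (auto simp: K_def direct_sum_def fun_eq_iff)
  qed
  have \<delta>Y: "\<delta> r (Suc i) (Y (Suc i) j) = \<phi> r i (Y i) (b i j)" if j: "j \<in> A (Suc i)" for i j
  proof (cases "i \<le> ?n")
    case True
    then show ?thesis using \<delta>y j by (simp add: Y_def)
  next
    case False
    \<comment> \<open>The equation takes place in \<open>K i\<close>, which is zero for i >
      \<open>?n\<close>.\<close>
    then show ?thesis
      using Y[of "Suc i"] j
      by (intro trivial[of i] mod_hom_closed[OF \<delta>] mod_hom_closed[OF \<phi>[OF Y]] bC) auto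
  qed
  have ru: "r \<le> u" using U_le[of 0] by (simp add: U_0)
  show ?thesis
  proof (intro exI[of _ "\<lambda>i. \<phi> r i (Y i)"] conjI allI ballI impI)
    show "chain_map R C (koszul M (pow_seq R s r)) (\<lambda>i. \<phi> r i (Y i))"
      unfolding chain_map_def cobj
      using \<phi>[OF Y] \<phi>_chain[OF ru Y Y \<delta>Y] by (simp add: \<delta>_def)
  next
    fix i x assume "x \<in> carrier (cobj C i)" "\<forall>j\<in>A i. c i j x = \<zero>"
    then show "\<phi> r i (Y i) x = kappa R M s u r i (q i x)"
      using \<phi>_zero_coords[OF Y] by (simp add: kappa_eq)
  qed
qed

end


section \<open>The complex \<open>T'\<close>\<close>

text \<open>Here \<open>q\<close> is the projection to the Koszul summand, the coordinates are those
  of the free summand, and \<open>w\<close> is the Koszul differential of the first component.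
  Elements \<open>(x, 0)\<close> have zero coordinates, which gives the restriction to the Koszul
  complex.\<close>

lemma (in module) chain_map_from_tprime:
  assumes kh: "kills_homology R M s h" and s: "set s \<subseteq> carrier R" and r: "r \<ge> 1"
    and u: "u = u_exp (length s) h l r"
    and tb: "tprime_choice R M (pow_seq R s u) t b"
  shows "\<exists>\<phi>. chain_map R (tprime R M (pow_seq R s u) t b) (koszul M (pow_seq R s r)) \<phi> \<and>
    (\<forall>i. \<forall>x\<in>carrier (cobj (koszul M (pow_seq R s u)) i).
       \<phi> i (x, \<zero>\<^bsub>free_module R {..<t i}\<^esub>) = kappa R M s u r i x)"
proof -
  let ?K = "koszul M (pow_seq R s u)"
  let ?F = "\<lambda>i. free_module R {..<t i}"
  define T where "T = tprime R M (pow_seq R s u) t b"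
  have cobj: "cobj T i = prod_module (cobj ?K i) (?F i)" for i
    by (simp add: T_def tprime_def Let_def)
  have ps: "set (pow_seq R s u) \<subseteq> carrier R"
    using s by (auto simp: pow_seq_def)
  have mK: "module R (cobj ?K i)" for i
    unfolding cobj_koszul by (rule module_direct_sum[OF module_axioms])
  have mF: "module R (?F i)" for i
    by (rule module_direct_sum[OF module_ring_module[OF R.is_cring]])
  have mT: "module R (cobj T i)" for i
    unfolding cobj by (rule module_prod_module[OF mK mF])
  have b: "b (Suc i) j \<in> cycles T i" if "j < t (Suc i)" for i j
  proof -
    \<comment> \<open>A generator exists in degree i + 1, while t vanishes at 0 and 1.\<close>
    have "Suc i \<ge> 2"
      using tb that by (cases i) (auto simp: tprime_choice_def)
    then obtain S where "S \<subseteq> cycles T (Suc i - 1)" "bij_betw (b (Suc i)) {..<t (Suc i)} S"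
      using tb unfolding tprime_choice_def T_def by blast
    then show ?thesis
      using that by (auto simp: bij_betw_def)
  qed
  have zeroF: "\<zero>\<^bsub>?F i\<^esub> = (\<lambda>_. \<zero>)" for i
    by simp
  have zeroF_closed: "\<zero>\<^bsub>?F i\<^esub> \<in> carrier (?F i)" for i
    by (rule abelian_groupE(2)[OF module.axioms(2)[OF mF]])
  have "\<exists>\<phi>. chain_map R T (koszul M (pow_seq R s r)) \<phi> \<and>
    (\<forall>i. \<forall>x\<in>carrier (cobj T i). (\<forall>j\<in>{..<t i}. snd x j = \<zero>) \<longrightarrow> \<phi> i x = kappa R M s u r i (fst x))"
  proof (rule chain_map_into_koszul[OF kh s r u mT, where c = "\<lambda>i j x. snd x j"
        and w = "\<lambda>i x. (cdiff ?K (Suc i) (fst x), \<zero>\<^bsub>?F i\<^esub>)" and b = "\<lambda>i. b (Suc i)"])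
    show "fst \<in> mod_hom R (cobj T i) (cobj ?K i)" for i
      unfolding cobj by (rule mod_homI) (auto simp: prod_module_def)
    show "(\<lambda>x. snd x j) \<in> mod_hom R (cobj T i) (ring_module R)" for i j
      unfolding cobj by (rule mod_homI) (auto simp: prod_module_def direct_sum_def)
    show "(cdiff ?K (Suc i) (fst x), \<zero>\<^bsub>?F i\<^esub>) \<in> carrier (cobj T i)"
      if "x \<in> carrier (cobj T (Suc i))" for i x
      using that mod_hom_closed[OF koszul_cdiff_hom[OF ps], of "fst x" i] zeroF_closed
      by (auto simp: cobj prod_module_def)
    show "cdiff T (Suc i) x = (cdiff ?K (Suc i) (fst x), \<zero>\<^bsub>?F i\<^esub>) \<oplus>\<^bsub>cobj T i\<^esub>
      (\<Oplus>\<^bsub>cobj T i\<^esub>j\<in>{..<t (Suc i)}. snd x j \<odot>\<^bsub>cobj T i\<^esub> b (Suc i) j)" for i x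
      by (cases x) (simp add: T_def tprime_def Let_def)
    show "{..<t 0} = {}" "{..<t (Suc 0)} = {}"
      using tb by (auto simp: tprime_choice_def)
  qed (use b in \<open>simp_all\<close>)
  then obtain \<phi> where "chain_map R T (koszul M (pow_seq R s r)) \<phi>"
    and \<phi>: "\<And>i x. x \<in> carrier (cobj T i) \<Longrightarrow> \<forall>j\<in>{..<t i}. snd x j = \<zero> \<Longrightarrow>
      \<phi> i x = kappa R M s u r i (fst x)"
    by blast
  moreover have "\<phi> i (x, \<zero>\<^bsub>?F i\<^esub>) = kappa R M s u r i x" if "x \<in> carrier (cobj ?K i)" for i x
    using \<phi>[of "(x, \<zero>\<^bsub>?F i\<^esub>)" i] that zeroF_closed[of i] by (simp add: cobj prod_module_def zeroF)
  ultimately show ?thesis unfolding T_def by blast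
qed


section \<open>Tate resolutions\<close>

lemma size_le_mon_degree:
  assumes "\<alpha> \<in> tate_monomials n"
  shows "size \<alpha> \<le> mon_degree \<alpha>"
proof -
  have "size \<alpha> = (\<Sum>v\<in>#\<alpha>. 1)" by simp
  also have "\<dots> \<le> mon_degree \<alpha>"
    unfolding mon_degree_def using assms
    by (intro sum_mset_mono) (auto simp: tate_monomials_def)
  finally show ?thesis .
qed

lemma fst_le_mon_degree: "v \<in># \<alpha> \<Longrightarrow> fst v \<le> mon_degree \<alpha>"
  by (auto simp: mon_degree_def dest!: multi_member_split)

text \<open>A monomial of degree m has at most m factors, counted with multiplicity, each among the
  finitely many variables of degree at most m. Hence each degree of the Tate complex is free of
  finite rank and all sums over its basis are finite.\<close>

lemma finite_tate_monomials_degree: "finite {\<alpha> \<in> tate_monomials n. mon_degree \<alpha> = m}"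
proof (rule finite_subset)
  show "{\<alpha> \<in> tate_monomials n. mon_degree \<alpha> = m} \<subseteq>
    (\<Union>k\<le>m. multisets_of_size (Sigma {..m} (\<lambda>i. {..<n i})) k)"
  proof
    fix \<alpha> assume \<alpha>: "\<alpha> \<in> {\<alpha> \<in> tate_monomials n. mon_degree \<alpha> = m}"
    have "v \<in> Sigma {..m} (\<lambda>i. {..<n i})" if "v \<in># \<alpha>" for v
      using \<alpha> that fst_le_mon_degree[OF that] by (cases v) (auto simp: tate_monomials_def)
    then have "\<alpha> \<in> multisets_of_size (Sigma {..m} (\<lambda>i. {..<n i})) (size \<alpha>)"
      by (auto simp: multisets_of_size_def)
    moreover have "size \<alpha> \<in> {..m}"
      using \<alpha> size_le_mon_degree by auto
    ultimately show "\<alpha> \<in> (\<Union>k\<le>m. multisets_of_size (Sigma {..m} (\<lambda>i. {..<n i})) k)"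
      by (rule UN_I[rotated])
  qed
  show "finite (\<Union>k\<le>m. multisets_of_size (Sigma {..m} (\<lambda>i. {..<n i})) k)"
    by (intro finite_UN_I finite_multisets_of_size) auto
qed

lemma tate_monomials_degree_0: "{\<alpha> \<in> tate_monomials n. mon_degree \<alpha> = 0} = {{#}}"
proof -
  have "\<alpha> = {#}" if "\<alpha> \<in> tate_monomials n" "mon_degree \<alpha> = 0" for \<alpha>
    using size_le_mon_degree[OF that(1)] that(2) by simp
  then show ?thesis by (auto simp: mon_degree_def tate_monomials_def)
qed

lemma tate_monomials_degree_1:
  "{\<alpha> \<in> tate_monomials n. mon_degree \<alpha> = Suc 0} = (\<lambda>j. {#(1, j)#}) ` {..<n 1}"
proof (intro equalityI subsetI)
  fix \<alpha> assume "\<alpha> \<in> {\<alpha> \<in> tate_monomials n. mon_degree \<alpha> = Suc 0}"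
  then have \<alpha>: "\<alpha> \<in> tate_monomials n" "mon_degree \<alpha> = Suc 0" by auto
  then have "size \<alpha> \<le> 1" "\<alpha> \<noteq> {#}"
    using size_le_mon_degree[OF \<alpha>(1)] by (auto simp: mon_degree_def)
  then have "size \<alpha> = 1" by (cases "size \<alpha>") auto
  then obtain v where "\<alpha> = {#v#}" using size_1_singleton_mset by blast
  then show "\<alpha> \<in> (\<lambda>j. {#(1, j)#}) ` {..<n 1}"
    using \<alpha> by (cases v) (auto simp: tate_monomials_def mon_degree_def)
qed (auto simp: tate_monomials_def mon_degree_def)

section \<open>Coordinates in free modules and the Tate complex\<close>

lemma direct_sum_eval_hom: "(\<lambda>x. x i) \<in> mod_hom R (direct_sum M A) M"
  by (rule mod_homI) (auto simp: direct_sum_def)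

lemma single_free_module:
  assumes "a \<in> carrier R" "i \<in> A" "cring R" "finite A"
  shows "single R i a \<in> carrier (free_module R A)"
proof -
  interpret cring R by fact
  show ?thesis
    using assms unfolding carrier_direct_sum_finite[OF assms(4)]
    by (auto simp: single_def)
qed

lemma free_module_expansion:
  assumes R: "cring R" and A: "finite A" and x: "x \<in> carrier (free_module R A)"
  shows "x = (\<Oplus>\<^bsub>free_module R A\<^esub>i\<in>A. x i \<odot>\<^bsub>free_module R A\<^esub> single R i \<one>\<^bsub>R\<^esub>)"
proof
  interpret cring R by fact
  interpret N: module R "ring_module R" by (rule module_ring_module[OF R])
  interpret F: module R "free_module R A" by (rule module_direct_sum[OF N.module_axioms])
  have xR: "x i \<in> carrier R" and xz: "i \<notin> A \<Longrightarrow> x i = \<zero>\<^bsub>R\<^esub>" for i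
    using x by (auto simp: direct_sum_def)
  fix k
  have "(\<Oplus>\<^bsub>free_module R A\<^esub>i\<in>A. x i \<odot>\<^bsub>free_module R A\<^esub> single R i \<one>\<^bsub>R\<^esub>) k
    = (\<Oplus>\<^bsub>ring_module R\<^esub>i\<in>A. (x i \<odot>\<^bsub>free_module R A\<^esub> single R i \<one>\<^bsub>R\<^esub>) k)"
    by (rule mod_hom_finsum[OF F.module_axioms N.module_axioms direct_sum_eval_hom A])
      (use xR R A in \<open>blast intro: F.smult_closed single_free_module\<close>)
  also have "\<dots> = (\<Oplus>\<^bsub>ring_module R\<^esub>i\<in>A. if k = i then x i else \<zero>\<^bsub>ring_module R\<^esub>)"
    using xR by (intro N.M.finsum_cong') (auto simp: single_def)
  also have "\<dots> = x k"
  proof (cases "k \<in> A")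
    case True
    then show ?thesis
      using N.M.finsum_singleton[OF True A, of x] xR by simp
  next
    case False
    then have "(\<Oplus>\<^bsub>ring_module R\<^esub>i\<in>A. if k = i then x i else \<zero>\<^bsub>ring_module R\<^esub>)
      = (\<Oplus>\<^bsub>ring_module R\<^esub>i\<in>A. \<zero>\<^bsub>ring_module R\<^esub>)"
      by (intro N.M.finsum_cong') auto
    also have "\<dots> = \<zero>\<^bsub>ring_module R\<^esub>" by (rule N.M.finsum_zero)
    finally show ?thesis using xz[OF False] by simp
  qed
  finally show "x k = (\<Oplus>\<^bsub>free_module R A\<^esub>i\<in>A. x i \<odot>\<^bsub>free_module R A\<^esub> single R i \<one>\<^bsub>R\<^esub>) k" by simp
qed

text \<open>In degrees 0 and 1 the Tate complex is the Koszul complex. From degree 2 on, every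
  monomial, including products of variables of degree 1, is treated as an adjoined generator; its
  boundary is a cycle because the differential squares to zero. Agreement with \<open>kappa\<close>
  is therefore claimed in degree 0 only.\<close>

lemma (in cring) chain_map_from_tate:
  assumes kh: "kills_homology R (ring_module R) s h" and s: "set s \<subseteq> carrier R" and r: "r \<ge> 1"
    and u: "u = u_exp (length s) h l r"
    and res: "tate_resolution R (pow_seq R s u) n D"
  shows "\<exists>\<phi>. chain_map R (tate_complex R n D) (koszul (ring_module R) (pow_seq R s r)) \<phi> \<and>
    (\<forall>a\<in>carrier R. \<phi> 0 (single R {#} a) = kappa R (ring_module R) s u r 0 (single R {} a) \<and>
       kappa R (ring_module R) s u r 0 (single R {} a) = single R {} a)"
proof -
  interpret N: module R "ring_module R" by (rule module_ring_module[OF is_cring])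
  let ?K = "koszul (ring_module R) (pow_seq R s u)"
  define C where "C = tate_complex R n D"
  define B where "B = (\<lambda>m. {\<alpha> \<in> tate_monomials n. mon_degree \<alpha> = m})"
  have B: "finite (B m)" for m
    unfolding B_def by (rule finite_tate_monomials_degree)
  have cobj: "cobj C m = free_module R (B m)" for m
    by (simp add: C_def tate_complex_def B_def)
  have cdiff: "cdiff C m = D" for m
    by (simp add: C_def tate_complex_def)
  have carrier: "carrier (cobj C m) = {x. (\<forall>\<alpha>. x \<alpha> \<in> carrier R) \<and> (\<forall>\<alpha>. \<alpha> \<notin> B m \<longrightarrow> x \<alpha> = \<zero>)}" for m
    unfolding cobj carrier_direct_sum_finite[OF B] by simp
  have D: "tate_differential R n D" and n1: "n 1 = length s"
    and D1: "\<And>j. j < length s \<Longrightarrow> D (single R {#(1, j)#} \<one>) = single R {#} (s ! j [^] u)"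
    using res by (auto simp: tate_resolution_def pow_seq_def)
  have D_lin: "D \<in> mod_hom R (tate_algebra R n) (tate_algebra R n)"
    and D_deg: "\<And>m x. x \<in> carrier (cobj C (Suc m)) \<Longrightarrow> D x \<in> carrier (cobj C m)"
    and DD: "\<And>x. x \<in> carrier (tate_algebra R n) \<Longrightarrow> D (D x) = \<zero>\<^bsub>tate_algebra R n\<^esub>"
    using D unfolding tate_differential_def C_def by blast+
  have in_algebra: "x \<in> carrier (tate_algebra R n)" if "x \<in> carrier (cobj C m)" for x m
    using that by (auto simp: cobj tate_algebra_def direct_sum_def B_def)
  interpret C: module R "cobj C m" for m
    unfolding cobj by (rule module_direct_sum[OF N.module_axioms])
  have D_hom: "D \<in> mod_hom R (cobj C (Suc m)) (cobj C m)" for m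
  proof (rule mod_homI)
    fix x assume x: "x \<in> carrier (cobj C (Suc m))"
    then show "D x \<in> carrier (cobj C m)" by (rule D_deg)
    show "D (x \<oplus>\<^bsub>cobj C (Suc m)\<^esub> y) = D x \<oplus>\<^bsub>cobj C m\<^esub> D y" if y: "y \<in> carrier (cobj C (Suc m))" for y
      using mod_hom_add[OF D_lin in_algebra[OF x] in_algebra[OF y]]
      by (simp add: cobj tate_algebra_def direct_sum_def)
    show "D (a \<odot>\<^bsub>cobj C (Suc m)\<^esub> x) = a \<odot>\<^bsub>cobj C m\<^esub> D x" if a: "a \<in> carrier R" for a
      using mod_hom_smult[OF D_lin a in_algebra[OF x]]
      by (simp add: cobj tate_algebra_def direct_sum_def)
  qed
  have single: "single R \<alpha> a \<in> carrier (cobj C m)" if "\<alpha> \<in> B m" "a \<in> carrier R" for \<alpha> m a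
    unfolding cobj by (rule single_free_module[OF that(2,1) is_cring B])
  have D_expand: "D x = (\<Oplus>\<^bsub>cobj C m\<^esub>\<alpha>\<in>B (Suc m). x \<alpha> \<odot>\<^bsub>cobj C m\<^esub> D (single R \<alpha> \<one>))"
    if x: "x \<in> carrier (cobj C (Suc m))" for x m
  proof -
    have xR: "x \<alpha> \<in> carrier R" for \<alpha>
      using x by (simp add: carrier)
    have "D x = D (\<Oplus>\<^bsub>cobj C (Suc m)\<^esub>\<alpha>\<in>B (Suc m). x \<alpha> \<odot>\<^bsub>cobj C (Suc m)\<^esub> single R \<alpha> \<one>)"
      unfolding cobj by (rule arg_cong[OF free_module_expansion[OF is_cring B x[unfolded cobj]]])
    also have "\<dots> = (\<Oplus>\<^bsub>cobj C m\<^esub>\<alpha>\<in>B (Suc m). D (x \<alpha> \<odot>\<^bsub>cobj C (Suc m)\<^esub> single R \<alpha> \<one>))"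
      using xR single by (intro mod_hom_finsum[OF C.module_axioms C.module_axioms D_hom B]) blast
    also have "\<dots> = (\<Oplus>\<^bsub>cobj C m\<^esub>\<alpha>\<in>B (Suc m). x \<alpha> \<odot>\<^bsub>cobj C m\<^esub> D (single R \<alpha> \<one>))"
      using xR single D_deg
      by (intro C.M.finsum_cong') (auto simp: mod_hom_smult[OF D_hom])
    finally show ?thesis .
  qed

  \<comment> \<open>The empty set corresponds to the monomial 1 and \<open>{j}\<close> to the j-th
    variable of degree 1. Above degree 1 there is no Koszul part, so \<open>q\<close> is
    zero.\<close>
  define q where "q = (\<lambda>i x I. if I \<subseteq> {..<length s} \<and> card I = i \<and> i \<le> (1 :: nat)
    then x (image_mset (Pair (1 :: nat)) (mset_set I)) else \<zero>)"
  define A where "A = (\<lambda>i. if i \<le> 1 then {} else B i)"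
  \<comment> \<open>The index is the target degree: from degree 1 to 0 the whole differential is
    Koszul, while in higher degrees it is entirely accounted for by the generators.\<close>
  define w where "w = (\<lambda>i x. if i = 0 then D x else \<zero>\<^bsub>cobj C i\<^esub>)"
  have carrierK: "carrier (cobj ?K i) = {x. (\<forall>I. x I \<in> carrier R) \<and>
      (\<forall>I. I \<notin> {I. I \<subseteq> {..<length s} \<and> card I = i} \<longrightarrow> x I = \<zero>)}" for i
    unfolding carrier_cobj_koszul by simp
  have q_hom: "q i \<in> mod_hom R (cobj C i) (cobj ?K i)" for i
  proof (rule mod_homI)
    show "q i x \<in> carrier (cobj ?K i)" if "x \<in> carrier (cobj C i)" for x
      using that by (auto simp: q_def carrierK carrier)
  qed (auto simp: q_def cobj cobj_koszul fun_eq_iff)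
  have ps: "set (pow_seq R s u) \<subseteq> carrier R"
    using s by (auto simp: pow_seq_def)
  have q_D: "q 0 (D x) = cdiff ?K (Suc 0) (q (Suc 0) x)" if x: "x \<in> carrier (cobj C (Suc 0))" for x
  proof
    fix J
    have xR: "x \<alpha> \<in> carrier R" for \<alpha>
      using x by (simp add: carrier)
    have sR: "s ! j [^] u \<in> carrier R" if "j < length s" for j
      using s that nth_mem by (intro nat_pow_closed) blast
    have D_var: "D (single R {#(Suc 0, j)#} \<one>) {#} = s ! j [^] u" if "j < length s" for j
      using D1[OF that] by (simp add: single_def)
    have qx: "q (Suc 0) x \<in> carrier (cobj ?K (Suc 0))"
      by (rule mod_hom_closed[OF q_hom x])
    then have qxR: "q (Suc 0) x I \<in> carrier R" for I
      by (simp add: carrierK)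
    show "q 0 (D x) J = cdiff ?K (Suc 0) (q (Suc 0) x) J"
    proof (cases "J = {}")
      case True
      have "q 0 (D x) J = D x {#}"
        by (simp add: True q_def)
      also have "\<dots> = (\<Oplus>\<^bsub>ring_module R\<^esub>\<alpha>\<in>B (Suc 0). (x \<alpha> \<odot>\<^bsub>cobj C 0\<^esub> D (single R \<alpha> \<one>)) {#})"
        unfolding D_expand[OF x]
        by (rule mod_hom_finsum[OF C.module_axioms N.module_axioms direct_sum_eval_hom[where M = "ring_module R" and A = "B 0", folded cobj] B])
          (use xR single D_deg in blast)
      \<comment> \<open>The monomials of degree 1 are exactly the variables, so the sum can be
        indexed by the positions in \<open>s\<close>.\<close>
      also have "\<dots> = (\<Oplus>\<^bsub>ring_module R\<^esub>j\<in>{..<length s}. (x {#(1, j)#} \<odot>\<^bsub>cobj C 0\<^esub> D (single R {#(1, j)#} \<one>)) {#})"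
        unfolding B_def tate_monomials_degree_1 n1
        by (rule N.M.finsum_reindex)
          (use xR in \<open>auto simp: D_var sR cobj inj_on_def\<close>)
      also have "\<dots> = (\<Oplus>\<^bsub>ring_module R\<^esub>j\<in>{..<length s}. (s ! j [^] u) \<otimes> q (Suc 0) x {j})"
        using xR sR
        by (intro N.M.finsum_cong') (auto simp: D_var cobj q_def m_comm)
      also have "\<dots> = cdiff ?K (Suc 0) (q (Suc 0) x) J"
        using qxR sR unfolding True
        by (subst N.koszul_cdiff[OF ps])
          (auto simp: pow_seq_def intro!: N.M.finsum_cong')
      finally show ?thesis .
    next
      case False
      then have J: "J \<notin> {I. I \<subseteq> {..<length s} \<and> card I = 0}"
        using finite_subset[of J "{..<length s}"] by auto
      then have "cdiff ?K (Suc 0) (q (Suc 0) x) J = \<zero>"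
        using mod_hom_closed[OF N.koszul_cdiff_hom[OF ps] qx] unfolding carrierK by blast
      with J show ?thesis by (auto simp: q_def)
    qed
  qed
  have "\<exists>\<phi>. chain_map R C (koszul (ring_module R) (pow_seq R s r)) \<phi> \<and>
    (\<forall>i. \<forall>x\<in>carrier (cobj C i). (\<forall>\<alpha>\<in>A i. x \<alpha> = \<zero>) \<longrightarrow> \<phi> i x = kappa R (ring_module R) s u r i (q i x))"
  proof (rule N.chain_map_into_koszul[OF kh s r u C.module_axioms _ _ _ q_hom, where c = "\<lambda>i \<alpha> x. x \<alpha>"
        and w = w and b = "\<lambda>i \<alpha>. D (single R \<alpha> \<one>)"])
    show "finite (A i)" "A 0 = {}" "A (Suc 0) = {}" for i
      by (auto simp: A_def B)
    show "(\<lambda>x. x \<alpha>) \<in> mod_hom R (cobj C i) (ring_module R)" for i \<alpha>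
      unfolding cobj by (rule direct_sum_eval_hom)
    fix i x assume x: "x \<in> carrier (cobj C (Suc i))"
    show "w i x \<in> carrier (cobj C i)"
      using D_deg x by (auto simp: w_def)
    show "q i (w i x) = cdiff ?K (Suc i) (q (Suc i) x)"
    proof (cases "i = 0")
      case True
      then show ?thesis using q_D x by (simp add: w_def)
    next
      case False
      have mK: "module R (cobj ?K i)" for i
        unfolding cobj_koszul by (rule module_direct_sum[OF N.module_axioms])
      have "q (Suc i) x = \<zero>\<^bsub>cobj ?K (Suc i)\<^esub>"
        using False by (auto simp: q_def cobj_koszul)
      then show ?thesis
        using False mod_hom_zero[OF mK mK N.koszul_cdiff_hom[OF ps]]
          mod_hom_zero[OF C.module_axioms mK q_hom] by (simp add: w_def)
    qed
    show "w i x \<alpha> = \<zero>" if "\<alpha> \<in> A i" for \<alpha>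
      using that by (auto simp: A_def w_def cobj split: if_splits)
    show "cdiff C (Suc i) x = w i x \<oplus>\<^bsub>cobj C i\<^esub>
      (\<Oplus>\<^bsub>cobj C i\<^esub>\<alpha>\<in>A (Suc i). x \<alpha> \<odot>\<^bsub>cobj C i\<^esub> D (single R \<alpha> \<one>))"
    proof (cases "i = 0")
      case True
      then show ?thesis
        using D_deg x C.M.r_zero by (simp add: cdiff w_def A_def)
    next
      case False
      then show ?thesis
        using D_deg[OF x] D_expand[OF x] C.M.l_zero by (simp add: cdiff w_def A_def)
    qed
  next
    fix i \<alpha> assume "\<alpha> \<in> A (Suc i)"
    then have i: "i \<noteq> 0" and \<alpha>: "\<alpha> \<in> B (Suc i)"
      by (auto simp: A_def split: if_splits)
    have "D (D (single R \<alpha> \<one>)) = \<zero>\<^bsub>cobj C (i - 1)\<^esub>"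
      using DD[OF in_algebra[OF single[OF \<alpha> one_closed]]] by (simp add: cobj tate_algebra_def direct_sum_def)
    then show "D (single R \<alpha> \<one>) \<in> cycles C i"
      using i D_deg[OF single[OF \<alpha> one_closed]]
      by (simp add: cycles_def a_kernel_def kernel_def cdiff)
  qed
  then obtain \<phi> where \<phi>: "chain_map R C (koszul (ring_module R) (pow_seq R s r)) \<phi>"
    "\<And>x. x \<in> carrier (cobj C 0) \<Longrightarrow> \<phi> 0 x = kappa R (ring_module R) s u r 0 (q 0 x)"
    by (auto simp: A_def)
  have "\<phi> 0 (single R {#} a) = kappa R (ring_module R) s u r 0 (single R {} a) \<and>
    kappa R (ring_module R) s u r 0 (single R {} a) = single R {} a" if a: "a \<in> carrier R" for a
  proof
    have "{#} \<in> B 0" unfolding B_def tate_monomials_degree_0 by simp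
    then have "\<phi> 0 (single R {#} a) = kappa R (ring_module R) s u r 0 (q 0 (single R {#} a))"
      by (intro \<phi>(2) single a)
    moreover have "q 0 (single R {#} a) = single R {} a"
    proof
      show "q 0 (single R {#} a) I = single R {} a I" for I
        using finite_subset[of I "{..<length s}"] by (auto simp: q_def single_def)
    qed
    ultimately show "\<phi> 0 (single R {#} a) = kappa R (ring_module R) s u r 0 (single R {} a)" by simp
    \<comment> \<open>At the empty set the coefficient is a power of an empty product, hence
      1.\<close>
    show "kappa R (ring_module R) s u r 0 (single R {} a) = single R {} a"
      using a s by (auto simp: kappa_def single_def fun_eq_iff
          intro!: r_null nat_pow_closed N.list_prod_closed)
  qed
  with \<phi>(1) show ?thesis unfolding C_def by blast
qed

theorem theorem3p5:
  fixes R :: "('a, 'p) ring_scheme"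
    and M :: "('a, 'b, 'q) module_scheme"
    and s :: "'a list"
    and r :: nat
  assumes "cring R" and "noetherian_ring R"
    and "module R M" and "fin_gen_module R M"
    and "set s \<subseteq> carrier R"
    and "r \<ge> 1"
  shows
    "(\<forall>h l u t b.
        kills_homology R M s h \<longrightarrow> stabilises_colon R M s l \<longrightarrow> u = u_exp (length s) h l r \<longrightarrow>
        tprime_choice R M (pow_seq R s u) t b \<longrightarrow>
        (\<exists>\<phi>. chain_map R (tprime R M (pow_seq R s u) t b) (koszul M (pow_seq R s r)) \<phi> \<and>
             (\<forall>i. \<forall>x\<in>carrier (cobj (koszul M (pow_seq R s u)) i).
                \<phi> i (x, \<zero>\<^bsub>free_module R {..<t i}\<^esub>) = kappa R M s u r i x)))
   \<and> (\<forall>h l u n D.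
        kills_homology R (ring_module R) s h \<longrightarrow> stabilises_colon R (ring_module R) s l \<longrightarrow>
        u = u_exp (length s) h l r \<longrightarrow>
        tate_resolution R (pow_seq R s u) n D \<longrightarrow>
        (\<exists>\<phi>. chain_map R (tate_complex R n D) (koszul (ring_module R) (pow_seq R s r)) \<phi> \<and>
             (\<forall>a\<in>carrier R.
                \<phi> 0 (single R {#} a) = kappa R (ring_module R) s u r 0 (single R {} a) \<and>
                kappa R (ring_module R) s u r 0 (single R {} a) = single R {} a)))"
proof -
  interpret R: cring R by fact
  interpret M: module R M by fact
  show ?thesis
  proof (intro conjI allI impI, goal_cases)
    case (1 h l u t b)
    from M.chain_map_from_tprime[OF 1(1) assms(5,6) 1(3,4)] show ?case .
  next
    case (2 h l u n D)
    from R.chain_map_from_tate[OF 2(1) assms(5,6) 2(3,4)] show ?case .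
  qed
qed

end
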